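(* Let $f\in\mathcal{HK}$ and for $re^{i\theta}\in D$ let $u_r(\theta)=P[f](re^{i\theta})$. (a) We have $\sup_{\theta\in[-\pi,\pi]}|P[f](re^{i\theta})|=o(1/(1-r))$ as $r\to1$. This estimate is sharp in the following sense: if $\psi: D\to(0,\infty)$ satisfies $\psi(re^{i\theta})=o(1/(1-r))$ as $r\to1$ (i.e. $\sup_{\theta\in[-\pi,\pi]}(1-r)\psi(re^{i\theta})\to0$ as $r\to1$), then there is a function $f\in\mathcal{HK}$ such that $P[f]\neq o(\psi)$ as $r\to 1$ (i.e. it is not the case that $\sup_{\theta\in[-\pi,\pi]}|P[f](re^{i\theta})|/\psi(re^{i\theta})\to0$ as $r\to1$). (b) Let $1\le p<\infty$. Then $\|u_r\|_p=o(1/(1-r))$ as $r\to1$. This estimate is sharp in the following sense: if $\psi:[0,1)\to(0,\infty)$ satisfies $\psi(r)=o(1/(1-r))$ as $r\to1$, then there is a function $f\in\mathcal{HK}$ such that, with $u_r(\theta)=P[f](re^{i\theta})$, $\|u_r\|_p\neq o(\psi(r))$ as $r\to1$ (i.e. $\|u_r\|_p/\psi(r)$ does not tend to $0$).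
   Context: $D=\{re^{i\theta}: 0\le r<1,\ -\pi\le\theta<\pi\}$ is the open unit disc. $\mathcal{HK}$ is the set of $2\pi$-periodic functions $f:\mathbb{R}\to\mathbb{R}$ that are Henstock--Kurzweil integrable over a period, equivalently with finite Alexiewicz norm $\|f\|:=\sup_I|\int_I f|$, the supremum being over intervals $I\subset\mathbb{R}$ of length at most $2\pi$ (all integrals of such $f$ are Henstock--Kurzweil integrals). The Poisson kernel is $\Phi_r(\theta)=\frac{1-r^2}{2\pi(1-2r\cos\theta+r^2)}$ and the Poisson integral of $f$ is $P[f](re^{i\theta})=\int_{-\pi}^{\pi}f(\phi)\Phi_r(\phi-\theta)\,d\phi$. $\|\cdot\|_p$ is the $L^p$ norm with respect to Lebesgue measure on $[-\pi,\pi]$. Limits $r\to1$ are from below. *)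

theory Defs
  imports "HOL-Analysis.Analysis" "HOL-Library.Landau_Symbols"
begin

text \<open>Suprema over circles, \<open>L\<^sup>p\<close> norms and their quotients are taken in \<^typ>\<open>ennreal\<close>, so that
  an unbounded supremum or a divergent integral is \<open>\<infinity>\<close> rather than an unspecified real number
  or \<open>0\<close>.\<close>

definition HK :: "(real \<Rightarrow> real) set" where
  "HK = {f. (\<forall>x. f (x + 2 * pi) = f x) \<and> f integrable_on {-pi..pi}}"

definition poisson_kernel :: "real \<Rightarrow> real \<Rightarrow> real" where
  "poisson_kernel r \<theta> = (1 - r\<^sup>2) / (2 * pi * (1 - 2 * r * cos \<theta> + r\<^sup>2))"

text \<open>The integral is the Henstock--Kurzweil integral. \<^const>\<open>Arg\<close> takes values in \<open>(-\<pi>, \<pi>]\<close>;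
  by periodicity of the kernel any other choice of the argument gives the same value, as the lemma
  below records.\<close>

definition poisson_integral :: "(real \<Rightarrow> real) \<Rightarrow> complex \<Rightarrow> real" where
  "poisson_integral f z =
     integral {-pi..pi} (\<lambda>\<phi>. f \<phi> * poisson_kernel (cmod z) (\<phi> - Arg z))"

lemma poisson_integral_rcis:
  assumes "0 \<le> r"
  shows "poisson_integral f (rcis r \<theta>) =
           integral {-pi..pi} (\<lambda>\<phi>. f \<phi> * poisson_kernel r (\<phi> - \<theta>))"
proof (cases "r = 0")
  case True
  then show ?thesis
    by (simp add: poisson_integral_def poisson_kernel_def)
next
  case False
  then have "rcis r \<theta> = rcis r (Arg (rcis r \<theta>))"
    using assms rcis_cmod_Arg[of "rcis r \<theta>"] by simp
  then have "cis \<theta> = cis (Arg (rcis r \<theta>))"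
    using False by (simp add: rcis_def)
  then have "cos (\<phi> - Arg (rcis r \<theta>)) = cos (\<phi> - \<theta>)" for \<phi>
    by (simp add: cos_diff complex_eq_iff)
  then show ?thesis
    using assms by (simp add: poisson_integral_def poisson_kernel_def)
qed

definition Lp_norm :: "real \<Rightarrow> (real \<Rightarrow> real) \<Rightarrow> ennreal" where
  "Lp_norm p u =
     (let J = \<integral>\<^sup>+\<theta>\<in>{-pi..pi}. ennreal (\<bar>u \<theta>\<bar> powr p) \<partial>lebesgue
      in if J = \<infinity> then \<infinity> else ennreal (enn2real J powr (1 / p)))"

text \<open>Little-o as \<open>r \<rightarrow> 1-\<close> for functions with values in \<open>[0, \<infinity>]\<close>; the comparison function is
  meant to be positive on \<open>[0, 1)\<close>. For real functions it is the usual notion.\<close>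

definition enn_smallo_1 :: "(real \<Rightarrow> ennreal) \<Rightarrow> (real \<Rightarrow> real) \<Rightarrow> bool" where
  "enn_smallo_1 g h \<longleftrightarrow> ((\<lambda>r. g r / ennreal (h r)) \<longlongrightarrow> 0) (at_left 1)"

lemma enn_smallo_1_ennreal_iff:
  fixes g h :: "real \<Rightarrow> real"
  assumes g: "\<And>r. 0 \<le> r \<Longrightarrow> r < 1 \<Longrightarrow> 0 \<le> g r"
    and h: "\<And>r. 0 \<le> r \<Longrightarrow> r < 1 \<Longrightarrow> 0 < h r"
  shows "enn_smallo_1 (\<lambda>r. ennreal (g r)) h \<longleftrightarrow> g \<in> o[at_left 1](h)"
proof -
  have ev: "\<forall>\<^sub>F r in at_left (1::real). 0 \<le> r \<and> r < 1"
    using eventually_at_left_real[of 0 1] by (auto elim: eventually_mono)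
  have "enn_smallo_1 (\<lambda>r. ennreal (g r)) h \<longleftrightarrow>
          ((\<lambda>r. ennreal (g r / h r)) \<longlongrightarrow> ennreal 0) (at_left 1)"
    unfolding enn_smallo_1_def ennreal_0
    by (rule tendsto_cong) (use ev in eventually_elim, simp add: divide_ennreal g h)
  also have "\<dots> \<longleftrightarrow> ((\<lambda>r. g r / h r) \<longlongrightarrow> 0) (at_left 1)"
    by (rule tendsto_ennreal_iff)
       (auto intro!: eventually_mono[OF ev] divide_nonneg_nonneg simp: g h less_imp_le)
  also have "\<dots> \<longleftrightarrow> g \<in> o[at_left 1](h)"
  proof
    assume "((\<lambda>r. g r / h r) \<longlongrightarrow> 0) (at_left 1)"
    then show "g \<in> o[at_left 1](h)"
      by (rule smalloI_tendsto) (use ev in eventually_elim, use h in force)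
  qed (rule smalloD_tendsto)
  finally show ?thesis .
qed

end

theory Submission
  imports Defs
begin

text \<open>Integrating by parts, a function whose primitive is bounded by \<open>\<epsilon>\<close> has a Poisson integral bounded by
  \<open>3\<epsilon> / (1 - r)\<close>, because \<open>|\<Phi>\<^sub>r'| \<le> 2 \<Phi>\<^sub>r / (1 - r)\<close>. Every \<open>f\<close> is such a function up to a continuous
  one, whose Poisson integral is bounded; this gives both upper estimates.

  For sharpness, \<open>\<integral> u\<^sub>r sin (n \<theta>) d\<theta> = r\<^sup>n \<integral> f sin (n \<phi>) d\<phi>\<close>, so with \<open>r = 1 - 1/(2n)\<close> the \<open>L\<^sup>1\<close> norm of
  \<open>u\<^sub>r\<close> is at least half the \<open>n\<close>-th sine coefficient of \<open>f\<close>. It remains to find \<open>f\<close> whose sine coefficients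
  beat a given \<open>o(n)\<close> infinitely often. Take \<open>f = F'\<close> for \<open>F\<close> a sum of terms \<open>2\<^sup>-\<^sup>k T\<^sub>k(x) cos (N\<^sub>k x)\<close> with convex
  bumps \<open>T\<^sub>k\<close> on \<open>[0, 2\<^sup>-\<^sup>k]\<close> and \<open>N\<^sub>k\<close> growing fast: \<open>F\<close> is continuous and differentiable away
  from \<open>0\<close>, and all terms have nonnegative cosine coefficients. A lower bound on the \<open>L\<^sup>1\<close> norm bounds
  the supremum and every \<open>L\<^sup>p\<close> norm from below.\<close>

subsection \<open>Integration by parts\<close>

text \<open>The indefinite Henstock--Kurzweil integral is continuous, so a polynomial
  \<open>G\<close> approximates it uniformly, and \<open>s\<close> is the derivative of
  \<open>G\<close>. This is the density of continuous functions in the Alexiewicz norm.\<close>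

lemma continuous_approx_primitive:
  fixes f :: "real \<Rightarrow> real"
  assumes f: "f integrable_on {a..b}" and e: "0 < e"
  obtains s where "continuous_on UNIV s"
    and "\<And>x. x \<in> {a..b} \<Longrightarrow> \<bar>integral {a..x} (\<lambda>t. f t - s t)\<bar> \<le> e"
proof -
  obtain G where "real_polynomial_function G"
    and G: "\<And>x. x \<in> {a..b} \<Longrightarrow> \<bar>integral {a..x} f - G x\<bar> < e / 2"
    using Stone_Weierstrass_real_polynomial_function
      [OF _ indefinite_integral_continuous_1[OF f], of "e / 2"] e by auto
  then obtain s where "real_polynomial_function s"
    and der: "\<And>x. (G has_real_derivative s x) (at x)"
    using has_real_derivative_polynomial_function by blast
  then have s: "continuous_on UNIV s"
    by (simp add: continuous_on_polymonial_function real_polynomial_function_eq)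
  have "\<bar>integral {a..x} (\<lambda>t. f t - s t)\<bar> \<le> e" if x: "x \<in> {a..b}" for x
  proof -
    have "(s has_integral (G x - G a)) {a..x}"
      using x by (intro fundamental_theorem_of_calculus)
        (auto intro: has_field_derivative_at_within[OF der]
          simp: has_real_derivative_iff_has_vector_derivative[symmetric])
    moreover have "f integrable_on {a..x}"
      using f x by (auto intro: integrable_on_subinterval)
    ultimately have "integral {a..x} (\<lambda>t. f t - s t) = integral {a..x} f - (G x - G a)"
      by (intro integral_unique has_integral_diff) (auto simp: integrable_integral)
    \<comment> \<open>The primitive vanishes at \<open>a\<close>, so \<open>G a\<close> is itself an
      approximation error; hence the halved tolerance.\<close>
    moreover have "\<bar>G a\<bar> < e / 2"
      using G[of a] x by simp
    ultimately show ?thesis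
      using G[OF x] by linarith
  qed
  with s that show thesis
    by blast
qed

text \<open>The constant \<open>C\<close> depends on \<open>h\<close> and the interval but not on
  \<open>k\<close>: multiplication by \<open>h\<close> is bounded in the Alexiewicz norm, which is
  what passing to a limit in the other factor requires.\<close>

lemma mult_C1_primitive_bound:
  fixes h :: "real \<Rightarrow> real"
  assumes "a \<le> b"
    and h: "\<And>x. (h has_real_derivative h' x) (at x)" and h': "continuous_on UNIV h'"
  obtains C where "0 \<le> C"
    and "\<And>k e. k integrable_on {a..b} \<Longrightarrow> (\<And>x. x \<in> {a..b} \<Longrightarrow> \<bar>integral {a..x} k\<bar> \<le> e) \<Longrightarrow>
           (\<lambda>x. k x * h x) integrable_on {a..b} \<and> \<bar>integral {a..b} (\<lambda>x. k x * h x)\<bar> \<le> C * e"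
proof -
  have bdd: "bounded (h' ` {a..b})"
    using h' by (intro compact_imp_bounded compact_continuous_image)
      (auto intro: continuous_on_subset)
  then obtain L where "L > 0" and L: "\<And>x. x \<in> {a..b} \<Longrightarrow> \<bar>h' x\<bar> \<le> L"
    unfolding bounded_pos by auto
  \<comment> \<open>\<open>h = h1 - h2\<close> with both parts increasing, so the second mean value theorem applies to each.\<close>
  define h1 where "h1 = (\<lambda>x. h x + L * x)"
  define h2 where "h2 = (\<lambda>x::real. L * x)"
  have mono1: "h1 x \<le> h1 y" if "a \<le> x" "x \<le> y" "y \<le> b" for x y
  proof (rule DERIV_nonneg_imp_nondecreasing[OF that(2)])
    fix t assume "x \<le> t" "t \<le> y"
    then have "\<bar>h' t\<bar> \<le> L"
      using L that by auto
    then show "\<exists>d. (h1 has_real_derivative d) (at t) \<and> 0 \<le> d"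
      unfolding h1_def by (intro exI[of _ "h' t + L"]) (auto intro!: derivative_eq_intros h)
  qed
  have mono2: "h2 x \<le> h2 y" if "a \<le> x" "x \<le> y" "y \<le> b" for x y
    using that \<open>L > 0\<close> by (simp add: h2_def)
  have mono_bound: "(\<lambda>x. k x * g x) integrable_on {a..b} \<and>
      \<bar>integral {a..b} (\<lambda>x. k x * g x)\<bar> \<le> (\<bar>g a\<bar> + 2 * \<bar>g b\<bar>) * e"
    if k: "k integrable_on {a..b}" and e: "\<And>x. x \<in> {a..b} \<Longrightarrow> \<bar>integral {a..x} k\<bar> \<le> e"
      and g: "\<And>x y. a \<le> x \<Longrightarrow> x \<le> y \<Longrightarrow> y \<le> b \<Longrightarrow> g x \<le> g y" for k g :: "real \<Rightarrow> real" and e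
  proof -
    obtain c where c: "c \<in> {a..b}"
      and I: "((\<lambda>x. g x * k x) has_integral
        (g a * integral {a..c} k + g b * integral {c..b} k)) {a..b}"
      by (rule second_mean_value_theorem_full[where g = g, OF k \<open>a \<le> b\<close> g])
    \<comment> \<open>The tail integral is a difference of two values of the primitive, hence the
      factor 2 in front of \<open>\<bar>g b\<bar>\<close>.\<close>
    have "integral {a..c} k + integral {c..b} k = integral {a..b} k"
      using c k by (intro Henstock_Kurzweil_Integration.integral_combine) auto
    then have "\<bar>integral {c..b} k\<bar> \<le> 2 * e" "\<bar>integral {a..c} k\<bar> \<le> e"
      using e[OF c] e[of b] \<open>a \<le> b\<close> by auto
    then have "\<bar>g a * integral {a..c} k\<bar> \<le> \<bar>g a\<bar> * e"
      "\<bar>g b * integral {c..b} k\<bar> \<le> \<bar>g b\<bar> * (2 * e)"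
      by (auto simp: abs_mult intro: mult_left_mono)
    then show ?thesis
      using I by (auto simp: mult.commute[of "k _"] integral_unique integrable_on_def algebra_simps)
  qed
  show thesis
  proof
    show "0 \<le> (\<bar>h1 a\<bar> + 2 * \<bar>h1 b\<bar>) + (\<bar>h2 a\<bar> + 2 * \<bar>h2 b\<bar>)"
      by simp
    fix k :: "real \<Rightarrow> real" and e
    assume k: "k integrable_on {a..b}" "\<And>x. x \<in> {a..b} \<Longrightarrow> \<bar>integral {a..x} k\<bar> \<le> e"
    note 1 = mono_bound[of k e h1, OF k mono1] and 2 = mono_bound[of k e h2, OF k mono2]
    have eq: "(\<lambda>x. k x * h x) = (\<lambda>x. k x * h1 x - k x * h2 x)"
      by (auto simp: h1_def h2_def algebra_simps)
    show "(\<lambda>x. k x * h x) integrable_on {a..b} \<and> \<bar>integral {a..b} (\<lambda>x. k x * h x)\<bar> \<le>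
        ((\<bar>h1 a\<bar> + 2 * \<bar>h1 b\<bar>) + (\<bar>h2 a\<bar> + 2 * \<bar>h2 b\<bar>)) * e"
      unfolding eq distrib_right[of _ _ e] using 1 2
      by (auto simp: integral_diff integrable_diff distrib_right[of _ _ e] intro!: order_trans[OF abs_triangle_ineq4] add_mono)
  qed
qed

text \<open>Both sides are continuous in \<open>f\<close> with respect to the Alexiewicz norm, and the formula is
  classical for continuous \<open>f\<close>.\<close>

lemma has_integral_by_parts_C1:
  fixes f h :: "real \<Rightarrow> real"
  assumes ab: "a \<le> b" and f: "f integrable_on {a..b}"
    and h: "\<And>x. (h has_real_derivative h' x) (at x)" and h': "continuous_on UNIV h'"
  shows "((\<lambda>x. f x * h x) has_integral
    (integral {a..b} f * h b - integral {a..b} (\<lambda>x. integral {a..x} f * h' x))) {a..b}"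
proof -
  obtain C where "0 \<le> C" and C:
    "\<And>k e. k integrable_on {a..b} \<Longrightarrow> (\<And>x. x \<in> {a..b} \<Longrightarrow> \<bar>integral {a..x} k\<bar> \<le> e) \<Longrightarrow>
       (\<lambda>x. k x * h x) integrable_on {a..b} \<and> \<bar>integral {a..b} (\<lambda>x. k x * h x)\<bar> \<le> C * e"
    using mult_C1_primitive_bound[OF ab h h'] by blast
  define I where "I k = integral {a..b} k * h b - integral {a..b} (\<lambda>x. integral {a..x} k * h' x)" for k
  \<comment> \<open>One summand for each source of error: the left-hand side, the boundary term and
    the remaining integral in \<open>I\<close>.\<close>
  define C' where "C' = C + \<bar>h b\<bar> + integral {a..b} (\<lambda>x. \<bar>h' x\<bar>)"
  have ch': "continuous_on {a..b} h'"
    using h' continuous_on_subset by blast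
  have intFh: "(\<lambda>x. integral {a..x} k * h' x) integrable_on {a..b}" if "k integrable_on {a..b}" for k
    by (intro integrable_continuous_real continuous_intros indefinite_integral_continuous_1 that ch')
  have fh: "(\<lambda>x. f x * h x) integrable_on {a..b}"
  proof -
    have "bounded ((\<lambda>x. integral {a..x} f) ` {a..b})"
      by (intro compact_imp_bounded compact_continuous_image indefinite_integral_continuous_1 f) auto
    then obtain e where "\<forall>x\<in>{a..b}. \<bar>integral {a..x} f\<bar> \<le> e"
      unfolding bounded_iff by auto
    then show ?thesis
      using C[OF f, of e] by simp
  qed
  \<comment> \<open>The formula is exact for \<open>s\<close>, and each side moves by at most a
    fixed multiple of \<open>e\<close> when \<open>s\<close> is replaced by
    \<open>f\<close>.\<close>
  have approx: "\<bar>integral {a..b} (\<lambda>x. f x * h x) - I f\<bar> \<le> C' * e" if e: "e > 0" for e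
  proof -
    obtain s where s: "continuous_on UNIV s"
      and fs: "\<And>x. x \<in> {a..b} \<Longrightarrow> \<bar>integral {a..x} (\<lambda>t. f t - s t)\<bar> \<le> e"
      using continuous_approx_primitive[OF f e] by blast
    have s': "continuous_on {a..b} s"
      using s continuous_on_subset by blast
    then have si: "s integrable_on {a..b}"
      by (rule integrable_continuous_real)
    have "((\<lambda>x. s x * h x) has_integral I s) {a..b}"
    proof (rule integration_by_parts_interior[OF bounded_bilinear_mult ab, where
          f = "\<lambda>x. integral {a..x} s" and g' = h'])
      show "continuous_on {a..b} (\<lambda>x. integral {a..x} s)"
        by (rule indefinite_integral_continuous_1[OF si])
      show "continuous_on {a..b} h"
        by (rule DERIV_continuous_on[OF has_field_derivative_at_within[OF h]])
      show "((\<lambda>x. integral {a..x} s) has_vector_derivative s x) (at x)" if "x \<in> {a<..<b}" for x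
      proof -
        have "((\<lambda>x. integral {a..x} s) has_vector_derivative s x) (at x within {a..b})"
          using integral_has_vector_derivative[OF s'] that by auto
        then show ?thesis
          using that by (metis at_within_Icc_at greaterThanLessThan_iff)
      qed
      show "(h has_vector_derivative h' x) (at x)" for x
        using h by (simp add: has_real_derivative_iff_has_vector_derivative)
      show "((\<lambda>x. integral {a..x} s * h' x) has_integral
        integral {a..b} s * h b - integral {a..a} s * h a - I s) {a..b}"
        using intFh[OF si] by (simp add: I_def has_integral_integral)
    qed
    then have sh: "(\<lambda>x. s x * h x) integrable_on {a..b}" "integral {a..b} (\<lambda>x. s x * h x) = I s"
      by (auto simp: integral_unique integrable_on_def)
    let ?k = "\<lambda>t. f t - s t"
    have k: "?k integrable_on {a..b}"
      by (intro integrable_diff f si)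
    have Ik: "I f - I s = I ?k"
    proof -
      have "integral {a..x} ?k = integral {a..x} f - integral {a..x} s" if "x \<in> {a..b}" for x
        using that by (intro integral_diff) (auto intro: integrable_on_subinterval[OF f] integrable_on_subinterval[OF si])
      then have "integral {a..b} (\<lambda>x. integral {a..x} ?k * h' x) =
        integral {a..b} (\<lambda>x. integral {a..x} f * h' x - integral {a..x} s * h' x)"
        "integral {a..b} ?k = integral {a..b} f - integral {a..b} s"
        using ab by (auto intro!: integral_cong simp: left_diff_distrib)
      then show ?thesis
        unfolding I_def integral_diff[OF intFh[OF f] intFh[OF si]] by (simp add: left_diff_distrib)
    qed
    have "norm (integral {a..b} (\<lambda>x. integral {a..x} ?k * h' x)) \<le> integral {a..b} (\<lambda>x. e * \<bar>h' x\<bar>)"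
      using fs by (intro Henstock_Kurzweil_Integration.integral_norm_bound_integral intFh[OF k] integrable_continuous_real)
        (auto intro!: continuous_intros ch' mult_right_mono simp: abs_mult)
    moreover have "\<bar>integral {a..b} ?k * h b\<bar> \<le> e * \<bar>h b\<bar>"
      using fs[of b] ab by (auto simp: abs_mult intro!: mult_right_mono)
    ultimately have "\<bar>I ?k\<bar> \<le> e * \<bar>h b\<bar> + e * integral {a..b} (\<lambda>x. \<bar>h' x\<bar>)"
      by (simp add: I_def)
    moreover have "\<bar>integral {a..b} (\<lambda>x. ?k x * h x)\<bar> \<le> C * e"
      using C[OF k fs] by blast
    moreover have "integral {a..b} (\<lambda>x. ?k x * h x) = integral {a..b} (\<lambda>x. f x * h x) - I s"
      using integral_diff[OF fh sh(1)] sh(2) by (simp add: algebra_simps)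
    ultimately show ?thesis
      using Ik by (simp add: C'_def algebra_simps)
  qed
  have "integral {a..b} (\<lambda>x. f x * h x) - I f = 0"
  proof (rule ccontr)
    assume ne: "\<not> ?thesis"
    define d where "d = \<bar>integral {a..b} (\<lambda>x. f x * h x) - I f\<bar>"
    have "0 \<le> C'"
      unfolding C'_def using \<open>0 \<le> C\<close> by (intro add_nonneg_nonneg integral_nonneg) 
        (auto intro!: integrable_continuous_real continuous_intros ch')
    \<comment> \<open>The \<open>+ 1\<close> keeps the denominator positive even if
      \<open>C' = 0\<close>; this choice of \<open>e\<close> contradicts
      \<open>approx\<close>.\<close>
    then have "C' * (d / (2 * (C' + 1))) < d" "d / (2 * (C' + 1)) > 0"
      using ne by (auto simp: d_def field_simps intro: add_nonneg_pos)
    then show False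
      using approx[of "d / (2 * (C' + 1))"] by (simp add: d_def)
  qed
  with fh show ?thesis
    by (simp add: I_def has_integral_integral)
qed

subsection \<open>The Poisson kernel\<close>

definition poisson_deriv :: "real \<Rightarrow> real \<Rightarrow> real" where
  "poisson_deriv r \<theta> = - ((1 - r\<^sup>2) * (2 * r * sin \<theta>)) / (2 * pi * (1 - 2 * r * cos \<theta> + r\<^sup>2)\<^sup>2)"

text \<open>Since \<open>- G (\<phi> - \<theta>)\<close> is a primitive in \<open>\<theta>\<close>,
  integrating over a period reduces to finding a primitive \<open>G\<close> on the line, whose
  periodic part cancels at the end points.\<close>

lemma has_integral_reflected_period:
  fixes G :: "real \<Rightarrow> real"
  assumes "\<And>x. (G has_real_derivative g x) (at x)"
  shows "((\<lambda>\<theta>. g (\<phi> - \<theta>)) has_integral (G (\<phi> + pi) - G (\<phi> - pi))) {-pi..pi}"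
proof -
  have "((\<lambda>\<theta>. - G (\<phi> - \<theta>)) has_real_derivative g (\<phi> - \<theta>)) (at \<theta> within {-pi..pi})" for \<theta>
  proof -
    have "((\<lambda>\<theta>. \<phi> - \<theta>) has_real_derivative - 1) (at \<theta>)"
      by (auto intro!: derivative_eq_intros)
    from DERIV_minus[OF DERIV_chain2[OF assms this]] show ?thesis
      using has_field_derivative_at_within by fastforce
  qed
  then have "((\<lambda>\<theta>. g (\<phi> - \<theta>)) has_integral (- G (\<phi> - pi) - - G (\<phi> - (- pi)))) {-pi..pi}"
    unfolding has_real_derivative_iff_has_vector_derivative
    by (intro fundamental_theorem_of_calculus) auto
  then show ?thesis
    by (simp add: algebra_simps)
qed

context
  fixes r :: real
  assumes r: "0 \<le> r" "r < 1"
begin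

lemma poisson_denom_ge: "(1 - r)\<^sup>2 \<le> 1 - 2 * r * cos \<theta> + r\<^sup>2"
  using r mult_left_mono[OF cos_le_one r(1), of \<theta>] by (simp add: power2_eq_square algebra_simps)

lemma poisson_denom_pos: "0 < 1 - 2 * r * cos \<theta> + r\<^sup>2"
proof -
  have "0 < (1 - r)\<^sup>2"
    using r by simp
  then show ?thesis
    using poisson_denom_ge[of \<theta>] by linarith
qed

lemma one_minus_sq_pos: "0 < 1 - r\<^sup>2"
  using r by (simp add: power_less_one_iff abs_square_less_1)

lemma poisson_kernel_pos: "0 < poisson_kernel r \<theta>"
  unfolding poisson_kernel_def using poisson_denom_pos[of \<theta>] one_minus_sq_pos by simp

lemma continuous_on_poisson_kernel [continuous_intros]:
  fixes g :: "'a::t2_space \<Rightarrow> real"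
  shows "continuous_on A g \<Longrightarrow> continuous_on A (\<lambda>x. poisson_kernel r (g x))"
  unfolding poisson_kernel_def using poisson_denom_pos[THEN less_imp_neq, THEN not_sym]
  by (auto intro!: continuous_intros)

lemma continuous_on_poisson_deriv [continuous_intros]:
  fixes g :: "'a::t2_space \<Rightarrow> real"
  shows "continuous_on A g \<Longrightarrow> continuous_on A (\<lambda>x. poisson_deriv r (g x))"
  unfolding poisson_deriv_def using poisson_denom_pos[THEN less_imp_neq, THEN not_sym]
  by (auto intro!: continuous_intros)

lemma DERIV_poisson_kernel: "(poisson_kernel r has_real_derivative poisson_deriv r \<theta>) (at \<theta>)"
proof -
  define D where "D = 1 - 2 * r * cos \<theta> + r\<^sup>2"
  have "D \<noteq> 0"
    using poisson_denom_pos[of \<theta>] by (simp add: D_def)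
  have "((\<lambda>\<theta>. 2 * pi * (1 - 2 * r * cos \<theta> + r\<^sup>2)) has_real_derivative 2 * pi * (2 * r * sin \<theta>)) (at \<theta>)"
    by (auto intro!: derivative_eq_intros)
  then have "((\<lambda>\<theta>. (1 - r\<^sup>2) / (2 * pi * (1 - 2 * r * cos \<theta> + r\<^sup>2))) has_real_derivative
      (0 * (2 * pi * D) - (1 - r\<^sup>2) * (2 * pi * (2 * r * sin \<theta>))) / ((2 * pi * D) * (2 * pi * D))) (at \<theta>)"
    using \<open>D \<noteq> 0\<close> unfolding D_def by (intro DERIV_divide DERIV_const) auto
  also have "(0 * (2 * pi * D) - (1 - r\<^sup>2) * (2 * pi * (2 * r * sin \<theta>))) / ((2 * pi * D) * (2 * pi * D)) = poisson_deriv r \<theta>"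
    using \<open>D \<noteq> 0\<close> unfolding poisson_deriv_def D_def[symmetric] by (simp add: power2_eq_square)
  finally show ?thesis
    unfolding poisson_kernel_def[abs_def] .
qed

lemma poisson_kernel_le: "poisson_kernel r \<theta> \<le> 1 / (1 - r)"
proof -
  have "poisson_kernel r \<theta> \<le> (1 - r\<^sup>2) / (2 * pi * (1 - r)\<^sup>2)"
    unfolding poisson_kernel_def using poisson_denom_ge[of \<theta>] r one_minus_sq_pos
    by (intro divide_left_mono mult_left_mono mult_pos_pos poisson_denom_pos) auto
  also have "\<dots> = (1 + r) / (2 * pi) / (1 - r)"
    using r by (simp add: power2_eq_square divide_simps) (simp add: algebra_simps)
  also have "(1 + r) / (2 * pi) \<le> 1"
    using r pi_ge_two by simp
  finally show ?thesis
    using r by (simp add: divide_right_mono)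
qed

text \<open>The denominator \<open>D\<close> is the squared modulus of
  \<open>1 - r * cis \<theta>\<close>. Both \<open>r * \<bar>sin \<theta>\<bar>\<close> and
  \<open>1 - r\<close> are at most its square root, so their product is at most
  \<open>D\<close>.\<close>

lemma abs_poisson_deriv_le: "\<bar>poisson_deriv r \<theta>\<bar> \<le> 2 / (1 - r) * poisson_kernel r \<theta>"
proof -
  define D where "D = 1 - 2 * r * cos \<theta> + r\<^sup>2"
  have D: "0 < D" "(1 - r)\<^sup>2 \<le> D"
    using poisson_denom_pos[of \<theta>] poisson_denom_ge[of \<theta>] by (simp_all add: D_def)
  have "1 - 2 * r * c + r\<^sup>2 * (c\<^sup>2 + s\<^sup>2) = (1 - r * c)\<^sup>2 + r\<^sup>2 * s\<^sup>2" for c s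
    by (simp add: power2_eq_square algebra_simps)
  from this[of "cos \<theta>" "sin \<theta>"] have "D = (1 - r * cos \<theta>)\<^sup>2 + r\<^sup>2 * (sin \<theta>)\<^sup>2"
    by (simp add: D_def)
  then have "(r * \<bar>sin \<theta>\<bar>)\<^sup>2 \<le> D"
    by (simp add: power_mult_distrib)
  moreover have "2 * (r * \<bar>sin \<theta>\<bar>) * (1 - r) \<le> (r * \<bar>sin \<theta>\<bar>)\<^sup>2 + (1 - r)\<^sup>2"
    by (rule sum_squares_bound)
  ultimately have "r * \<bar>sin \<theta>\<bar> * (1 - r) \<le> D"
    using D by linarith
  then have *: "2 * r * \<bar>sin \<theta>\<bar> / D \<le> 2 / (1 - r)"
    using r D by (simp add: field_simps)
  have "\<bar>poisson_deriv r \<theta>\<bar> = (2 * r * \<bar>sin \<theta>\<bar> / D) * poisson_kernel r \<theta>"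
    unfolding poisson_deriv_def poisson_kernel_def D_def[symmetric]
    using r D one_minus_sq_pos by (simp add: abs_mult abs_divide power2_eq_square ac_simps)
  also have "\<dots> \<le> 2 / (1 - r) * poisson_kernel r \<theta>"
    by (intro mult_right_mono * less_imp_le poisson_kernel_pos)
  finally show ?thesis .
qed

text \<open>The arctangent is the argument of \<open>1 / (1 - r e\<^sup>i\<^sup>x)\<close>, that is \<open>\<Sum> r\<^sup>n sin (n x) / n\<close>; unlike the
  usual primitive in terms of \<open>tan (x / 2)\<close> this one is smooth on the whole line.\<close>

lemma DERIV_poisson_primitive:
  "((\<lambda>x. (x + 2 * arctan (r * sin x / (1 - r * cos x))) / (2 * pi)) has_real_derivative poisson_kernel r x) (at x)"
proof -
  define c s where "c = cos x" and "s = sin x"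
  have cs: "s\<^sup>2 = 1 - c\<^sup>2"
    by (simp add: c_def s_def sin_squared_eq)
  have "r * c \<le> r * 1"
    unfolding c_def using r by (intro mult_left_mono) auto
  then have p: "1 - r * c > 0"
    using r by simp
  have D: "1 - 2 * r * c + r\<^sup>2 > 0"
    using poisson_denom_pos[of x] by (simp add: c_def)
  have eq: "1 + (r * s / (1 - r * c))\<^sup>2 = (1 - 2 * r * c + r\<^sup>2) / (1 - r * c)\<^sup>2"
  proof -
    have "(1 - r * c)\<^sup>2 + (r * s)\<^sup>2 = 1 - 2 * r * c + r\<^sup>2 * (c\<^sup>2 + s\<^sup>2)"
      by (simp add: power2_eq_square algebra_simps)
    then have "(1 - r * c)\<^sup>2 + (r * s)\<^sup>2 = 1 - 2 * r * c + r\<^sup>2"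
      using cs by simp
    moreover have "1 + (r * s / (1 - r * c))\<^sup>2 = ((1 - r * c)\<^sup>2 + (r * s)\<^sup>2) / (1 - r * c)\<^sup>2"
      using p by (simp add: power_divide add_divide_distrib)
    ultimately show ?thesis
      by simp
  qed
  have q: "((\<lambda>x. r * sin x / (1 - r * cos x)) has_real_derivative
      (r * c - r\<^sup>2) / (1 - r * c)\<^sup>2) (at x)"
  proof -
    have "r * c * (1 - r * c) - r * s * (r * s) = r * c - r\<^sup>2 * (c\<^sup>2 + s\<^sup>2)"
      by (simp add: power2_eq_square algebra_simps)
    also have "\<dots> = r * c - r\<^sup>2"
      using cs by simp
    finally have *: "r * c * (1 - r * c) - r * s * (r * s) = r * c - r\<^sup>2" .
    show ?thesis
      unfolding *[symmetric] using p unfolding c_def s_def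
      by (auto intro!: derivative_eq_intros simp: power2_eq_square)
  qed
  have "((\<lambda>x. arctan (r * sin x / (1 - r * cos x))) has_real_derivative
      inverse (1 + (r * s / (1 - r * c))\<^sup>2) * ((r * c - r\<^sup>2) / (1 - r * c)\<^sup>2)) (at x)"
    unfolding c_def s_def by (rule DERIV_chain2[OF DERIV_arctan q[unfolded c_def s_def]])
  also have "inverse (1 + (r * s / (1 - r * c))\<^sup>2) * ((r * c - r\<^sup>2) / (1 - r * c)\<^sup>2) =
      (r * c - r\<^sup>2) / (1 - 2 * r * c + r\<^sup>2)"
    unfolding eq using p by simp
  finally have "((\<lambda>x. arctan (r * sin x / (1 - r * cos x))) has_real_derivative
      (r * c - r\<^sup>2) / (1 - 2 * r * c + r\<^sup>2)) (at x)" .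
  from DERIV_cdivide[OF DERIV_add[OF DERIV_ident DERIV_cmult[OF this, of 2]], of "2 * pi"]
  have "((\<lambda>x. (x + 2 * arctan (r * sin x / (1 - r * cos x))) / (2 * pi)) has_real_derivative
     (1 + 2 * ((r * c - r\<^sup>2) / (1 - 2 * r * c + r\<^sup>2))) / (2 * pi)) (at x)" .
  also have "(1 + 2 * ((r * c - r\<^sup>2) / (1 - 2 * r * c + r\<^sup>2))) / (2 * pi) = poisson_kernel r x"
    unfolding poisson_kernel_def c_def[symmetric] using D by (simp add: field_simps)
  finally show ?thesis .
qed

text \<open>The arctangent in the primitive is periodic and cancels over a period; only the linear
  term contributes.\<close>

lemma has_integral_poisson_kernel: "((\<lambda>\<theta>. poisson_kernel r (\<phi> - \<theta>)) has_integral 1) {-pi..pi}"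
  using has_integral_reflected_period[OF DERIV_poisson_primitive, of \<phi>]
  by (simp add: field_simps sin_add cos_add sin_diff cos_diff)

end

text \<open>Multiplying the kernel by its denominator gives a three-term recurrence for the moments.\<close>

lemma poisson_moments:
  fixes r \<phi> :: real
  assumes r: "0 < r" "r < 1"
  shows "((\<lambda>\<theta>. poisson_kernel r (\<phi> - \<theta>) * cos (real n * (\<phi> - \<theta>))) has_integral r ^ n) {-pi..pi}" (is "?A n")
    and "((\<lambda>\<theta>. poisson_kernel r (\<phi> - \<theta>) * sin (real n * (\<phi> - \<theta>))) has_integral 0) {-pi..pi}" (is "?B n")
proof -
  note r' = less_imp_le[OF r(1)] r(2)
  have D: "0 < 1 - 2 * r * cos x + r\<^sup>2" for x
    by (rule poisson_denom_pos[OF r'])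
  have denom: "poisson_kernel r x * (1 + r\<^sup>2) - poisson_kernel r x * (2 * r * cos x) = (1 - r\<^sup>2) / (2 * pi)" for x
  proof -
    have "poisson_kernel r x * (1 + r\<^sup>2) - poisson_kernel r x * (2 * r * cos x) =
        poisson_kernel r x * (1 - 2 * r * cos x + r\<^sup>2)"
      by (simp add: algebra_simps)
    then show ?thesis
      using D[of x] by (simp add: poisson_kernel_def)
  qed
  have trig0: "((\<lambda>\<theta>. cos (real (Suc n) * (\<phi> - \<theta>))) has_integral 0) {-pi..pi}"
    "((\<lambda>\<theta>. sin (real (Suc n) * (\<phi> - \<theta>))) has_integral 0) {-pi..pi}" for n
  proof -
    have 1: "((\<lambda>x. sin (real (Suc n) * x) / real (Suc n)) has_real_derivative cos (real (Suc n) * x)) (at x)"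
      "((\<lambda>x. - cos (real (Suc n) * x) / real (Suc n)) has_real_derivative sin (real (Suc n) * x)) (at x)" for x
      by (auto intro!: derivative_eq_intros simp del: of_nat_Suc)
    have 2: "sin (real (Suc n) * (\<phi> + pi)) = sin (real (Suc n) * (\<phi> - pi))"
      "cos (real (Suc n) * (\<phi> + pi)) = cos (real (Suc n) * (\<phi> - pi))"
      by (simp_all add: distrib_left right_diff_distrib sin_add cos_add sin_diff cos_diff del: of_nat_Suc)
    show "((\<lambda>\<theta>. cos (real (Suc n) * (\<phi> - \<theta>))) has_integral 0) {-pi..pi}"
      "((\<lambda>\<theta>. sin (real (Suc n) * (\<phi> - \<theta>))) has_integral 0) {-pi..pi}"
      using has_integral_reflected_period[OF 1(1), of \<phi>] has_integral_reflected_period[OF 1(2), of \<phi>] 2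
      by simp_all
  qed
  have A0: "?A 0"
    using has_integral_poisson_kernel[OF r', of \<phi>] by simp
  \<comment> \<open>The recurrence needs two starting values. Integrating \<open>denom\<close> over
    a period gives the first cosine moment from the total mass.\<close>
  have A1: "?A (Suc 0)"
  proof -
    have "((\<lambda>\<theta>. (poisson_kernel r (\<phi> - \<theta>) * (1 + r\<^sup>2) - (1 - r\<^sup>2) / (2 * pi)) / (2 * r))
        has_integral (1 * (1 + r\<^sup>2) - (1 - r\<^sup>2) / (2 * pi) * (2 * pi)) / (2 * r)) {-pi..pi}"
      using has_integral_const_real[of "(1 - r\<^sup>2) / (2 * pi)" "-pi" pi]
      by (intro has_integral_divide has_integral_diff has_integral_mult_left has_integral_poisson_kernel[OF r'])
        (simp add: mult.commute)
    also have "(\<lambda>\<theta>. (poisson_kernel r (\<phi> - \<theta>) * (1 + r\<^sup>2) - (1 - r\<^sup>2) / (2 * pi)) / (2 * r)) =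
        (\<lambda>\<theta>. poisson_kernel r (\<phi> - \<theta>) * cos (\<phi> - \<theta>))"
    proof
      show "(poisson_kernel r (\<phi> - \<theta>) * (1 + r\<^sup>2) - (1 - r\<^sup>2) / (2 * pi)) / (2 * r) =
          poisson_kernel r (\<phi> - \<theta>) * cos (\<phi> - \<theta>)" for \<theta>
        unfolding denom[of "\<phi> - \<theta>", symmetric] using r by simp
    qed
    also have "(1 * (1 + r\<^sup>2) - (1 - r\<^sup>2) / (2 * pi) * (2 * pi)) / (2 * r) = r"
      using r by (simp add: power2_eq_square)
    finally show ?thesis
      by simp
  qed
  have B1: "?B (Suc 0)"
  proof -
    \<comment> \<open>The kernel times the sine is a multiple of the logarithmic derivative of the
      denominator, which is periodic.\<close>
    have "((\<lambda>x. (1 - r\<^sup>2) / (4 * pi * r) * ln (1 - 2 * r * cos x + r\<^sup>2)) has_real_derivative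
        poisson_kernel r x * sin x) (at x)" for x
      using D[of x] r unfolding poisson_kernel_def
      by (auto intro!: derivative_eq_intros simp: divide_simps)
    from has_integral_reflected_period[OF this, of \<phi>] show ?thesis
      by (simp add: cos_add cos_diff)
  qed
  \<comment> \<open>Sine and cosine are treated together through \<open>t\<close>: both satisfy the
    same addition identity, and the constant from \<open>denom\<close> contributes 0 because of
    \<open>t0\<close>.\<close>
  have step: "((\<lambda>\<theta>. poisson_kernel r (\<phi> - \<theta>) * t (real (Suc (Suc n)) * (\<phi> - \<theta>)))
      has_integral ((1 + r\<^sup>2) * b - r * a) / r) {-pi..pi}"
    if t: "\<And>x. t (real n * x) + t (real (Suc (Suc n)) * x) = 2 * cos x * t (real (Suc n) * x)"
      and t0: "((\<lambda>\<theta>. t (real (Suc n) * (\<phi> - \<theta>))) has_integral 0) {-pi..pi}"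
      and a: "((\<lambda>\<theta>. poisson_kernel r (\<phi> - \<theta>) * t (real n * (\<phi> - \<theta>))) has_integral a) {-pi..pi}"
      and b: "((\<lambda>\<theta>. poisson_kernel r (\<phi> - \<theta>) * t (real (Suc n) * (\<phi> - \<theta>))) has_integral b) {-pi..pi}"
    for t :: "real \<Rightarrow> real" and n a b
  proof -
    have "((\<lambda>\<theta>. ((1 + r\<^sup>2) * (poisson_kernel r (\<phi> - \<theta>) * t (real (Suc n) * (\<phi> - \<theta>)))
        - r * (poisson_kernel r (\<phi> - \<theta>) * t (real n * (\<phi> - \<theta>)))
        - (1 - r\<^sup>2) / (2 * pi) * t (real (Suc n) * (\<phi> - \<theta>))) / r)
      has_integral ((1 + r\<^sup>2) * b - r * a - (1 - r\<^sup>2) / (2 * pi) * 0) / r) {-pi..pi}"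
      by (intro has_integral_divide has_integral_diff has_integral_mult_right t0 a b)
    moreover have "((1 + r\<^sup>2) * (poisson_kernel r x * t (real (Suc n) * x))
        - r * (poisson_kernel r x * t (real n * x))
        - (1 - r\<^sup>2) / (2 * pi) * t (real (Suc n) * x)) / r = poisson_kernel r x * t (real (Suc (Suc n)) * x)" for x
    proof -
      have "(1 + r\<^sup>2) * (poisson_kernel r x * t (real (Suc n) * x))
        - r * (poisson_kernel r x * t (real n * x))
        - (1 - r\<^sup>2) / (2 * pi) * t (real (Suc n) * x)
        = r * poisson_kernel r x * (2 * cos x * t (real (Suc n) * x) - t (real n * x))"
        unfolding denom[of x, symmetric] by (simp add: algebra_simps del: of_nat_Suc)
      also have "2 * cos x * t (real (Suc n) * x) - t (real n * x) = t (real (Suc (Suc n)) * x)"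
        using t[of x] by linarith
      finally show ?thesis
        using r by simp
    qed
    ultimately show ?thesis
      by simp
  qed
  \<comment> \<open>The recurrence has order two, so the induction carries two consecutive
    indices.\<close>
  have "?A n \<and> ?A (Suc n) \<and> ?B n \<and> ?B (Suc n)"
  proof (induction n)
    case 0
    then show ?case
      using A0 A1 B1 by simp
  next
    case (Suc n)
    have *: "real (Suc (Suc n)) * x = real (Suc n) * x + x" "real n * x = real (Suc n) * x - x" for x
      by (simp_all add: algebra_simps)
    have t: "cos (real n * x) + cos (real (Suc (Suc n)) * x) = 2 * cos x * cos (real (Suc n) * x)"
      "sin (real n * x) + sin (real (Suc (Suc n)) * x) = 2 * cos x * sin (real (Suc n) * x)" for x
      unfolding * cos_add cos_diff sin_add sin_diff by simp_all
    have "((1 + r\<^sup>2) * r ^ Suc n - r * r ^ n) / r = r ^ Suc (Suc n)"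
      using r by (simp add: power2_eq_square field_simps)
    with Suc step[OF t(1) trig0(1), of "r ^ n" "r ^ Suc n"] step[OF t(2) trig0(2), of 0 0] show ?case
      by simp
  qed
  then show "?A n" "?B n"
    by auto
qed

subsection \<open>Large sine coefficients\<close>

text \<open>Squaring the truncated line makes it continuously differentiable and keeps it convex.
  Only \<open>x \<ge> 0\<close> matters; to the left of 0 the function grows.\<close>

definition bump :: "real \<Rightarrow> real \<Rightarrow> real" where
  "bump l x = (max 0 (1 - x / l))\<^sup>2"

lemma bump_eq_0: "0 < l \<Longrightarrow> l \<le> x \<Longrightarrow> bump l x = 0"
  by (simp add: bump_def max_def)

lemma abs_bump_le: "0 < l \<Longrightarrow> 0 \<le> x \<Longrightarrow> \<bar>bump l x\<bar> \<le> 1"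
  by (simp add: bump_def power_le_one)

lemma continuous_on_bump [continuous_intros]:
  "continuous_on A g \<Longrightarrow> continuous_on A (\<lambda>x. bump l (g x))"
  unfolding bump_def by (cases "l = 0") (auto intro!: continuous_intros)

lemma DERIV_bump:
  assumes "0 < l"
  shows "(bump l has_real_derivative - 2 * max 0 (1 - x / l) / l) (at x)"
proof -
  have sq: "((\<lambda>y::real. (max 0 y)\<^sup>2) has_real_derivative 2 * max 0 y) (at y)" for y
  proof -
    consider "y < 0" | "y = 0" | "y > 0" by linarith
    then show ?thesis
    proof cases
      case 1
      then have "\<forall>\<^sub>F z in nhds y. (max 0 z)\<^sup>2 = (0::real)"
        using eventually_nhds_in_open[of "{..<0}" y] by (auto elim!: eventually_mono)
      then show ?thesis
        using 1 by (subst DERIV_cong_ev[where g = "\<lambda>_. 0" and v = 0]) auto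
    next
      case 2
      \<comment> \<open>At the kink the difference quotient of the squared positive part is the
        positive part itself, which tends to 0.\<close>
      have "((\<lambda>h::real. max 0 h) \<longlongrightarrow> max 0 0) (at 0)"
        by (intro tendsto_intros)
      moreover have "\<forall>\<^sub>F h in at (0::real). max 0 h = ((max 0 h)\<^sup>2 - (max 0 0)\<^sup>2) / h"
        by (auto simp: eventually_at_filter max_def power2_eq_square)
      ultimately show ?thesis
        using 2 by (auto simp: DERIV_def elim!: Lim_transform_eventually)
    next
      case 3
      then have "\<forall>\<^sub>F z in nhds y. (max 0 z)\<^sup>2 = (z::real)\<^sup>2"
        using eventually_nhds_in_open[of "{0<..}" y] by (auto elim!: eventually_mono)
      moreover have "((\<lambda>z. z\<^sup>2) has_real_derivative 2 * y) (at y)"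
        by (auto intro!: derivative_eq_intros)
      ultimately show ?thesis
        using 3 by (subst DERIV_cong_ev[where g = "\<lambda>z. z\<^sup>2" and v = "2 * y"]) auto
    qed
  qed
  have "((\<lambda>x. 1 - x / l) has_real_derivative - 1 / l) (at x)"
    using assms by (auto intro!: derivative_eq_intros)
  from DERIV_chain2[OF sq this] show ?thesis
    unfolding bump_def[abs_def] by simp
qed

text \<open>Convexity of the bump is what makes its cosine transform nonnegative.\<close>

lemma integral_bump_cos_nonneg:
  assumes l: "0 < l" "l \<le> pi"
  shows "0 \<le> integral {0..pi} (\<lambda>x. bump l x * cos (m * x))"
    and "integral {0..pi} (bump l) = l / 3"
proof -
  have restrict: "(f has_integral I) {0..pi}"
    if "((\<lambda>x. (1 - x / l)\<^sup>2 * g x) has_integral I) {0..l}" and "\<And>x. f x = bump l x * g x" for f g I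
  proof -
    have 1: "(f has_integral I) {0..l}"
      by (rule has_integral_eq[OF _ that(1)]) (use l that(2) in \<open>auto simp: bump_def max_def\<close>)
    have 2: "(f has_integral 0) {l..pi}"
      by (rule has_integral_eq[OF _ has_integral_0]) (use l that(2) in \<open>auto simp: bump_eq_0\<close>)
    show ?thesis
      using has_integral_combine[OF _ _ 1 2] l by simp
  qed
  have "((\<lambda>x. (1 - x / l)\<^sup>2 * 1) has_integral (- (l / 3) * (1 - l / l) ^ 3 - - (l / 3) * (1 - 0 / l) ^ 3)) {0..l}"
  proof (rule fundamental_theorem_of_calculus)
    fix x
    have "((\<lambda>x. - (l / 3) * (1 - x / l) ^ 3) has_real_derivative (1 - x / l)\<^sup>2 * 1) (at x)"
      using l by (auto intro!: derivative_eq_intros)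
    then show "((\<lambda>x. - (l / 3) * (1 - x / l) ^ 3) has_vector_derivative (1 - x / l)\<^sup>2 * 1) (at x within {0..l})"
      unfolding has_real_derivative_iff_has_vector_derivative by (rule has_vector_derivative_at_within)
  qed (use l in simp)
  from restrict[OF this, of "bump l"] show I0: "integral {0..pi} (bump l) = l / 3"
    using l by (auto dest: integral_unique)
  have pos: "0 \<le> integral {0..pi} (\<lambda>x. bump l x * cos (m * x))" if m: "m > 0" for m
  proof -
    \<comment> \<open>A primitive found by integrating by parts twice. At \<open>l\<close> only its
      last term survives, at 0 only its middle one.\<close>
    let ?G = "\<lambda>x. (1 - x / l)\<^sup>2 * sin (m * x) / m - 2 * (1 - x / l) * cos (m * x) / (m\<^sup>2 * l)
      - 2 * sin (m * x) / (m ^ 3 * l\<^sup>2)"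
    have "((\<lambda>x. (1 - x / l)\<^sup>2 * cos (m * x)) has_integral (?G l - ?G 0)) {0..l}"
    proof (rule fundamental_theorem_of_calculus)
      fix x
      have "(?G has_real_derivative (1 - x / l)\<^sup>2 * cos (m * x)) (at x)"
      proof -
        define y S C where "y = 1 - x / l" and "S = sin (m * x)" and "C = cos (m * x)"
        have dy: "((\<lambda>x. 1 - x / l) has_real_derivative - (1 / l)) (at x)"
          using l by (auto intro!: derivative_eq_intros)
        have dS: "((\<lambda>x. sin (m * x)) has_real_derivative C * m) (at x)"
          and dC: "((\<lambda>x. cos (m * x)) has_real_derivative - S * m) (at x)"
          by (auto intro!: derivative_eq_intros simp: S_def C_def)
        have "(?G has_real_derivative
          (2 * y * - (1 / l) * S + C * m * y\<^sup>2) / m - (2 * - (1 / l) * C + - S * m * (2 * y)) / (m\<^sup>2 * l)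
           - 2 * (C * m) / (m ^ 3 * l\<^sup>2)) (at x)"
          using DERIV_diff[OF DERIV_diff[OF DERIV_cdivide[OF DERIV_mult[OF DERIV_power[OF dy, of 2] dS], of m]
              DERIV_cdivide[OF DERIV_mult[OF DERIV_cmult[OF dy, of 2] dC], of "m\<^sup>2 * l"]]
              DERIV_cdivide[OF DERIV_cmult[OF dS, of 2], of "m ^ 3 * l\<^sup>2"]]
          by (simp add: y_def S_def C_def mult.assoc)
        moreover have "(2 * y * - (1 / l) * S + C * m * y\<^sup>2) / m - (2 * - (1 / l) * C + - S * m * (2 * y)) / (m\<^sup>2 * l)
           - 2 * (C * m) / (m ^ 3 * l\<^sup>2) = y\<^sup>2 * C"
          using l m by (simp add: add_divide_distrib diff_divide_distrib power2_eq_square power3_eq_cube)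
        ultimately show ?thesis
          by (simp add: y_def C_def)
      qed
      then show "(?G has_vector_derivative (1 - x / l)\<^sup>2 * cos (m * x)) (at x within {0..l})"
        unfolding has_real_derivative_iff_has_vector_derivative by (rule has_vector_derivative_at_within)
    qed (use l in simp)
    then have "integral {0..pi} (\<lambda>x. bump l x * cos (m * x)) = ?G l - ?G 0"
      by (intro integral_unique restrict[where g = "\<lambda>x. cos (m * x)"]) auto
    also have "\<dots> = 2 * (m * l) / (m ^ 3 * l\<^sup>2) - 2 * sin (m * l) / (m ^ 3 * l\<^sup>2)"
      using l m by (simp add: power2_eq_square power3_eq_cube)
    also have "\<dots> = 2 * (m * l - sin (m * l)) / (m ^ 3 * l\<^sup>2)"
      by (simp add: diff_divide_distrib)
    also have "\<dots> \<ge> 0"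
      using l m sin_x_le_x[of "m * l"] by (intro divide_nonneg_nonneg) auto
    finally show ?thesis .
  qed
  \<comment> \<open>The frequency differences \<open>N k - N j\<close> used below may be negative;
    evenness of the cosine covers them.\<close>
  consider "m = 0" | "m > 0" | "- m > 0" by linarith
  then show "0 \<le> integral {0..pi} (\<lambda>x. bump l x * cos (m * x))"
  proof cases
    case 1
    then show ?thesis using I0 l by simp
  next
    case 3
    then show ?thesis using pos[of "- m"] by simp
  qed (rule pos)
qed

text \<open>The supports shrink to \<open>0\<close>, so the series is locally finite on \<open>(0, \<infinity>)\<close> whatever the frequencies,
  while the cosine coefficients of all terms are nonnegative and therefore cannot cancel.\<close>

definition humps :: "(nat \<Rightarrow> nat) \<Rightarrow> real \<Rightarrow> real" where
  "humps N x = (\<Sum>k. (1/2) ^ k * (bump ((1/2) ^ k) x * cos (real (N k) * x)))"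

lemma uniform_limit_humps:
  "uniform_limit {0..pi} (\<lambda>n x. \<Sum>k<n. (1/2) ^ k * (bump ((1/2) ^ k) x * cos (real (N k) * x))) (humps N) sequentially"
  unfolding humps_def
proof (rule Weierstrass_m_test)
  show "norm ((1/2) ^ k * (bump ((1/2) ^ k) x * cos (real (N k) * x))) \<le> (1/2) ^ k" if "x \<in> {0..pi}" for k x
  proof -
    have "\<bar>bump ((1/2) ^ k) x\<bar> * \<bar>cos (real (N k) * x)\<bar> \<le> 1 * 1"
      using that by (intro mult_mono abs_bump_le) auto
    then show ?thesis
      by (simp add: abs_mult)
  qed
qed (simp add: summable_geometric)

lemma continuous_on_humps: "continuous_on {0..pi} (humps N)"
  by (rule uniform_limit_theorem[OF _ uniform_limit_humps])
    (auto intro!: always_eventually continuous_intros)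

text \<open>To the right of \<open>(1/2) ^ n\<close> only the terms with \<open>k < n\<close> can be
  nonzero, so near \<open>x\<close> the series is a finite sum of differentiable functions.
  \<open>deriv\<close> names the derivative without a formula.\<close>

lemma DERIV_humps:
  assumes "0 < x"
  shows "(humps N has_real_derivative deriv (humps N) x) (at x)"
proof -
  let ?t = "\<lambda>k x. (1/2) ^ k * (bump ((1/2) ^ k) x * cos (real (N k) * x))"
  obtain n where n: "(1/2) ^ n < x"
    using assms real_arch_pow_inv[of x "1/2"] by auto
  have *: "(\<Sum>k<n. ?t k y) = humps N y" if "y \<in> {(1/2) ^ n<..}" for y
    unfolding humps_def
  proof (rule suminf_finite[symmetric])
    fix k assume "k \<notin> {..<n}"
    then have "(1/2) ^ k \<le> (1/2 :: real) ^ n"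
      by (intro power_decreasing) auto
    also have "\<dots> < y"
      using that by simp
    finally have "bump ((1/2) ^ k) y = 0"
      by (intro bump_eq_0) auto
    then show "?t k y = 0"
      by simp
  qed simp
  have "(\<lambda>y. \<Sum>k<n. ?t k y) field_differentiable (at x)"
  proof (intro field_differentiable_sum field_differentiable_mult field_differentiable_const)
    show "bump ((1/2) ^ k) field_differentiable at x" for k
      using DERIV_bump[of "(1/2) ^ k" x] by (auto simp: field_differentiable_def)
    show "(\<lambda>y. cos (real (N k) * y)) field_differentiable at x" for k
      unfolding field_differentiable_def by (rule exI) (auto intro!: derivative_eq_intros)
  qed
  then obtain D where "((\<lambda>y. \<Sum>k<n. ?t k y) has_real_derivative D) (at x)"
    by (auto simp: field_differentiable_def)
  then have "(humps N has_real_derivative D) (at x)"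
    by (rule has_field_derivative_transform_within_open[where S = "{(1/2) ^ n<..}"]) (use n * in auto)
  then show ?thesis
    by (simp add: DERIV_imp_deriv)
qed

text \<open>The product formula turns each term into bump integrals with frequencies
  \<open>N k - N j\<close> and \<open>N k + N j\<close>, all nonnegative. For \<open>k = j\<close>
  the first frequency is 0 and yields \<open>(1/2) ^ j / 2 * ((1/2) ^ j / 3)\<close>; everything
  else is discarded.\<close>

lemma integral_humps_cos_ge:
  "(1/4) ^ j / 6 \<le> integral {0..pi} (\<lambda>x. humps N x * cos (real (N j) * x))"
proof -
  let ?t = "\<lambda>k x. (1/2) ^ k * (bump ((1/2) ^ k) x * cos (real (N k) * x))"
  let ?l = "\<lambda>k. (1/2 :: real) ^ k"
  have l: "0 < ?l k" "?l k \<le> pi" for k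
    using power_le_one[of "1/2::real" k] pi_ge_two by auto
  have term_eq: "integral {0..pi} (\<lambda>x. ?t k x * cos (real (N j) * x)) = ?l k / 2 *
     (integral {0..pi} (\<lambda>x. bump (?l k) x * cos ((real (N k) - real (N j)) * x))
      + integral {0..pi} (\<lambda>x. bump (?l k) x * cos ((real (N k) + real (N j)) * x)))" for k
  proof -
    have "(\<lambda>x. ?t k x * cos (real (N j) * x)) = (\<lambda>x. ?l k / 2 *
      (bump (?l k) x * cos ((real (N k) - real (N j)) * x) + bump (?l k) x * cos ((real (N k) + real (N j)) * x)))"
      by (rule ext) (simp add: distrib_right left_diff_distrib cos_add cos_diff algebra_simps)
    then show ?thesis
      by (simp only: integral_mult_right) (subst integral_add, auto intro!: integrable_continuous_real continuous_intros)
  qed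
  have term_nonneg: "0 \<le> integral {0..pi} (\<lambda>x. ?t k x * cos (real (N j) * x))" for k
    unfolding term_eq using l by (intro mult_nonneg_nonneg add_nonneg_nonneg integral_bump_cos_nonneg) auto
  have term_j: "(1/4) ^ j / 6 \<le> integral {0..pi} (\<lambda>x. ?t j x * cos (real (N j) * x))"
  proof -
    have "?l j / 2 * (?l j / 3 + 0) \<le> integral {0..pi} (\<lambda>x. ?t j x * cos (real (N j) * x))"
      unfolding term_eq using l integral_bump_cos_nonneg[OF l, of j]
      by (intro mult_left_mono add_mono) auto
    also have "?l j / 2 * (?l j / 3 + 0) = (1/4) ^ j / 6"
      by (simp flip: power_mult_distrib)
    finally show ?thesis .
  qed
  have lim: "uniform_limit {0..pi} (\<lambda>n x. (\<Sum>k<n. ?t k x) * cos (real (N j) * x))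
      (\<lambda>x. humps N x * cos (real (N j) * x)) sequentially"
    by (intro uniform_lim_mult uniform_limit_humps uniform_limit_const)
      (auto intro!: compact_imp_bounded compact_continuous_image continuous_on_humps continuous_intros)
  obtain I J where I: "\<And>n. ((\<lambda>x. (\<Sum>k<n. ?t k x) * cos (real (N j) * x)) has_integral I n) {0..pi}"
    and J: "((\<lambda>x. humps N x * cos (real (N j) * x)) has_integral J) {0..pi}" and "I \<longlonglongrightarrow> J"
    by (rule uniform_limit_integral[OF lim]) (auto intro!: continuous_intros)
  \<comment> \<open>The partial sum has to contain term \<open>j\<close>; the other terms do not
    decrease it.\<close>
  have "(1/4) ^ j / 6 \<le> I n" if "n > j" for n
  proof -
    have "I n = integral {0..pi} (\<lambda>x. \<Sum>k<n. ?t k x * cos (real (N j) * x))"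
      using integral_unique[OF I[of n]] by (simp add: sum_distrib_right)
    also have "\<dots> = (\<Sum>k<n. integral {0..pi} (\<lambda>x. ?t k x * cos (real (N j) * x)))"
      by (intro integral_sum) (auto intro!: integrable_continuous_real continuous_intros)
    also have "\<dots> \<ge> integral {0..pi} (\<lambda>x. ?t j x * cos (real (N j) * x))"
      using that term_nonneg by (intro member_le_sum) auto
    finally show ?thesis
      using term_j by linarith
  qed
  then have "(1/4) ^ j / 6 \<le> J"
    using \<open>I \<longlonglongrightarrow> J\<close> by (intro LIMSEQ_le_const) (auto intro!: exI[of _ "Suc j"])
  then show ?thesis
    using J by (simp add: integral_unique)
qed

text \<open>Each \<open>x\<close> is translated by whole periods into \<open>[-pi, pi)\<close>. The
  point \<open>pi\<close> lands at \<open>- pi\<close>, which is where the condition on the end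
  values enters.\<close>

lemma HK_extend:
  assumes g: "g integrable_on {-pi..pi}" and ends: "g pi = g (- pi)"
  obtains f where "f \<in> HK" and "\<And>x. x \<in> {-pi..pi} \<Longrightarrow> f x = g x"
proof
  define f where "f x = g (x - 2 * pi * of_int \<lfloor>(x + pi) / (2 * pi)\<rfloor>)" for x
  show eq: "f x = g x" if "x \<in> {-pi..pi}" for x
  proof (cases "x = pi")
    case True
    then show ?thesis
      using ends by (simp add: f_def)
  next
    case False
    then have "\<lfloor>(x + pi) / (2 * pi)\<rfloor> = 0"
      using that by (simp add: floor_eq_iff field_simps)
    then show ?thesis
      by (simp add: f_def)
  qed
  have "f (x + 2 * pi) = f x" for x
  proof -
    have "(x + 2 * pi + pi) / (2 * pi) = (x + pi) / (2 * pi) + 1"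
      by (simp add: field_simps)
    then have fl: "\<lfloor>(x + 2 * pi + pi) / (2 * pi)\<rfloor> = \<lfloor>(x + pi) / (2 * pi)\<rfloor> + 1"
      by simp
    show ?thesis
      unfolding f_def fl by (simp add: algebra_simps)
  qed
  moreover have "f integrable_on {-pi..pi}"
    by (rule integrable_eq[OF g]) (simp add: eq)
  ultimately show "f \<in> HK"
    by (simp add: HK_def)
qed

text \<open>As \<open>N k\<close> may be chosen depending on \<open>(1/4)\<^sup>k\<close>, these coefficients beat any prescribed \<open>o(n)\<close>
  infinitely often.\<close>

lemma HK_large_sine_coefficients:
  obtains f where "f \<in> HK"
    and "\<And>k. real (N k) * (1/4) ^ k / 6 \<le> \<bar>integral {-pi..pi} (\<lambda>x. f x * sin (real (N k) * x))\<bar>"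
proof -
  let ?F = "humps N"
  \<comment> \<open>The default 0 covers the point 0, about which \<open>DERIV_humps\<close> says
    nothing, and both ends of the period, so that the periodic extension is consistent.\<close>
  define g where "g x = (if 0 < x \<and> x < pi then deriv ?F x else 0)" for x
  have F': "(?F has_vector_derivative g x) (at x)" if "x \<in> {0<..<pi}" for x
    using DERIV_humps[of x N] that by (simp add: g_def has_real_derivative_iff_has_vector_derivative)
  have left: "((\<lambda>x. g x * s x) has_integral 0) {-pi..0}" for s
    by (rule has_integral_eq[OF _ has_integral_0]) (simp add: g_def)
  \<comment> \<open>This form of the fundamental theorem asks only for continuity of the primitive
    at the end points, so \<open>g\<close> is Henstock--Kurzweil integrable however wildly it
    oscillates near 0.\<close>
  have "((\<lambda>x. g x * 1) has_integral (?F pi - ?F 0)) {0..pi}"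
    using fundamental_theorem_of_calculus_interior[OF pi_ge_zero continuous_on_humps F'] by simp
  from has_integral_combine[OF _ _ left this] have gi: "g integrable_on {-pi..pi}"
    by (auto simp: integrable_on_def)
  \<comment> \<open>The sine vanishes at 0 and at \<open>pi\<close>, so no boundary terms remain.
    Differentiation multiplies the cosine coefficient by \<open>n\<close>, which is the source of
    the growth.\<close>
  have coeff: "real n * integral {0..pi} (\<lambda>x. ?F x * cos (real n * x)) =
      - integral {-pi..pi} (\<lambda>x. g x * sin (real n * x))" for n
  proof -
    let ?I = "integral {0..pi} (\<lambda>x. ?F x * cos (real n * x))"
    have "((\<lambda>x. g x * sin (real n * x)) has_integral - (real n * ?I)) {0..pi}"
    proof (rule integration_by_parts_interior[OF bounded_bilinear_mult pi_ge_zero continuous_on_humps _ F'])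
      show "((\<lambda>x. sin (real n * x)) has_vector_derivative real n * cos (real n * x)) (at x)" for x
        unfolding has_real_derivative_iff_has_vector_derivative[symmetric]
        by (auto intro!: derivative_eq_intros)
      have "((\<lambda>x. real n * (?F x * cos (real n * x))) has_integral real n * ?I) {0..pi}"
        by (intro has_integral_mult_right integrable_integral integrable_continuous_real
            continuous_intros continuous_on_humps)
      then show "((\<lambda>x. ?F x * (real n * cos (real n * x))) has_integral
        ?F pi * sin (real n * pi) - ?F 0 * sin (real n * 0) - - (real n * ?I)) {0..pi}"
        by (simp add: ac_simps)
    qed (auto intro!: continuous_intros)
    from has_integral_combine[OF _ _ left this] show ?thesis
      by (simp add: integral_unique)
  qed
  obtain f where f: "f \<in> HK" "\<And>x. x \<in> {-pi..pi} \<Longrightarrow> f x = g x"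
    using HK_extend[OF gi] by (auto simp: g_def)
  have "real (N k) * (1/4) ^ k / 6 \<le> \<bar>integral {-pi..pi} (\<lambda>x. f x * sin (real (N k) * x))\<bar>" for k
  proof -
    have "integral {-pi..pi} (\<lambda>x. f x * sin (real (N k) * x)) = integral {-pi..pi} (\<lambda>x. g x * sin (real (N k) * x))"
      using f(2) by (intro integral_cong) simp
    moreover have "real (N k) * ((1/4) ^ k / 6) \<le> real (N k) * integral {0..pi} (\<lambda>x. ?F x * cos (real (N k) * x))"
      by (intro mult_left_mono integral_humps_cos_ge) simp
    ultimately show ?thesis
      unfolding coeff by simp
  qed
  with f(1) that show thesis
    by blast
qed

subsection \<open>Poisson integrals\<close>

lemma DERIV_shift_diff:
  "(g has_real_derivative D) (at (\<phi> - \<theta>)) \<Longrightarrow> ((\<lambda>x. g (x - \<theta>)) has_real_derivative D) (at \<phi>)"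
  using DERIV_shift[of g D \<phi> "- \<theta>"] by simp

lemma HK_integrable: "f \<in> HK \<Longrightarrow> f integrable_on {-pi..pi}"
  by (simp add: HK_def)

lemma poisson_kernel_minus_commute: "poisson_kernel r (\<phi> - \<theta>) = poisson_kernel r (\<theta> - \<phi>)"
  using cos_minus[of "\<phi> - \<theta>"] by (simp add: poisson_kernel_def)

context
  fixes f :: "real \<Rightarrow> real" and r :: real
  assumes f: "f integrable_on {-pi..pi}" and r: "0 \<le> r" "r < 1"
begin

text \<open>The integrand on the right contains only continuous functions, so norm bounds,
  continuity in \<open>\<theta>\<close> and exchange of integrals become available for
  Henstock--Kurzweil integrable \<open>f\<close>.\<close>

lemma has_integral_poisson_by_parts:
  "((\<lambda>\<phi>. f \<phi> * poisson_kernel r (\<phi> - \<theta>)) has_integral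
    (integral {-pi..pi} f * poisson_kernel r (pi - \<theta>) -
     integral {-pi..pi} (\<lambda>\<phi>. integral {-pi..\<phi>} f * poisson_deriv r (\<phi> - \<theta>)))) {-pi..pi}"
  by (rule has_integral_by_parts_C1[OF _ f])
    (auto intro!: DERIV_shift_diff DERIV_poisson_kernel r continuous_on_poisson_deriv continuous_intros)

text \<open>The boundary term contributes \<open>e / (1 - r)\<close>; the derivative bound and the
  unit mass of the kernel contribute \<open>2 * e / (1 - r)\<close>.\<close>

lemma abs_poisson_le:
  assumes e: "\<And>x. x \<in> {-pi..pi} \<Longrightarrow> \<bar>integral {-pi..x} f\<bar> \<le> e"
  shows "\<bar>integral {-pi..pi} (\<lambda>\<phi>. f \<phi> * poisson_kernel r (\<phi> - \<theta>))\<bar> \<le> 3 * e / (1 - r)"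
proof -
  have "0 \<le> e"
    using e[of 0] by auto
  have K: "((\<lambda>\<phi>. poisson_kernel r (\<phi> - \<theta>)) has_integral 1) {-pi..pi}"
    using has_integral_poisson_kernel[OF r, of \<theta>] by (simp add: poisson_kernel_minus_commute)
  have "norm (integral {-pi..pi} (\<lambda>\<phi>. integral {-pi..\<phi>} f * poisson_deriv r (\<phi> - \<theta>))) \<le>
      integral {-pi..pi} (\<lambda>\<phi>. e * (2 / (1 - r)) * poisson_kernel r (\<phi> - \<theta>))"
  proof (rule Henstock_Kurzweil_Integration.integral_norm_bound_integral)
    show "(\<lambda>\<phi>. integral {-pi..\<phi>} f * poisson_deriv r (\<phi> - \<theta>)) integrable_on {-pi..pi}"
      by (intro integrable_continuous_real continuous_intros indefinite_integral_continuous_1 f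
          continuous_on_poisson_deriv r)
    show "(\<lambda>\<phi>. e * (2 / (1 - r)) * poisson_kernel r (\<phi> - \<theta>)) integrable_on {-pi..pi}"
      using has_integral_mult_right[OF K, of "e * (2 / (1 - r))"] by (auto simp: integrable_on_def)
    show "norm (integral {-pi..x} f * poisson_deriv r (x - \<theta>)) \<le> e * (2 / (1 - r)) * poisson_kernel r (x - \<theta>)"
      if "x \<in> {-pi..pi}" for x
      unfolding real_norm_def abs_mult mult.assoc[of e]
      using e[OF that] \<open>0 \<le> e\<close> by (intro mult_mono abs_poisson_deriv_le r) auto
  qed
  also have "\<dots> = 2 * e / (1 - r)"
    unfolding integral_unique[OF has_integral_mult_right[OF K, of "e * (2 / (1 - r))"]] by simp
  finally have "\<bar>integral {-pi..pi} (\<lambda>\<phi>. integral {-pi..\<phi>} f * poisson_deriv r (\<phi> - \<theta>))\<bar> \<le> 2 * e / (1 - r)"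
    by simp
  moreover have "\<bar>integral {-pi..pi} f * poisson_kernel r (pi - \<theta>)\<bar> \<le> e * (1 / (1 - r))"
    unfolding abs_mult using e[of pi] \<open>0 \<le> e\<close> poisson_kernel_le[OF r] poisson_kernel_pos[OF r, of "pi - \<theta>"]
    by (intro mult_mono) auto
  ultimately show ?thesis
    using integral_unique[OF has_integral_poisson_by_parts[of \<theta>]] by (simp add: add_divide_distrib[symmetric])
qed

text \<open>Joint continuity gives the continuity of the Poisson integral and, later, the exchange
  of the order of integration.\<close>

lemma continuous_on_indefinite_poisson_deriv:
  "continuous_on (UNIV \<times> {-pi..pi}) (\<lambda>(\<theta>, \<phi>). integral {-pi..\<phi>} f * poisson_deriv r (\<phi> - \<theta>))"
  unfolding split_beta
  by (intro continuous_intros continuous_on_poisson_deriv r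
      continuous_on_compose2[OF indefinite_integral_continuous_1[OF f]]) auto

lemma continuous_on_poisson:
  "continuous_on UNIV (\<lambda>\<theta>. integral {-pi..pi} (\<lambda>\<phi>. f \<phi> * poisson_kernel r (\<phi> - \<theta>)))"
  unfolding integral_unique[OF has_integral_poisson_by_parts]
  using integral_continuous_on_param[where a = "-pi" and b = pi and U = UNIV]
    continuous_on_indefinite_poisson_deriv
  by (intro continuous_intros continuous_on_poisson_kernel r) auto

end

section \<open>Sine coefficients of the Poisson integral\<close>

lemma poisson_kernel_trig:
  fixes r \<phi> :: real
  assumes r: "0 < r" "r < 1"
  shows "((\<lambda>\<theta>. poisson_kernel r (\<phi> - \<theta>) * sin (real n * \<theta>)) has_integral r ^ n * sin (real n * \<phi>)) {-pi..pi}"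
    and "((\<lambda>\<theta>. poisson_kernel r (\<phi> - \<theta>) * cos (real n * \<theta>)) has_integral r ^ n * cos (real n * \<phi>)) {-pi..pi}"
    and "((\<lambda>\<theta>. poisson_deriv r (\<phi> - \<theta>) * sin (real n * \<theta>)) has_integral real n * (r ^ n * cos (real n * \<phi>))) {-pi..pi}"
proof -
  note M = poisson_moments[OF r, of \<phi> n]
  \<comment> \<open>Expanding about \<open>\<phi>\<close> leaves only the kernel moments, of which
    the sine moment is 0.\<close>
  have eq: "real n * \<theta> = real n * \<phi> - real n * (\<phi> - \<theta>)" for \<theta>
    by (simp add: algebra_simps)
  have sin_eq: "poisson_kernel r (\<phi> - \<theta>) * sin (real n * \<theta>) =
      sin (real n * \<phi>) * (poisson_kernel r (\<phi> - \<theta>) * cos (real n * (\<phi> - \<theta>))) -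
      cos (real n * \<phi>) * (poisson_kernel r (\<phi> - \<theta>) * sin (real n * (\<phi> - \<theta>)))" for \<theta>
    by (subst eq, subst sin_diff) (simp add: right_diff_distrib)
  have cos_eq: "poisson_kernel r (\<phi> - \<theta>) * cos (real n * \<theta>) =
      cos (real n * \<phi>) * (poisson_kernel r (\<phi> - \<theta>) * cos (real n * (\<phi> - \<theta>))) +
      sin (real n * \<phi>) * (poisson_kernel r (\<phi> - \<theta>) * sin (real n * (\<phi> - \<theta>)))" for \<theta>
    by (subst eq, subst cos_diff) (simp add: distrib_left)
  show "((\<lambda>\<theta>. poisson_kernel r (\<phi> - \<theta>) * sin (real n * \<theta>)) has_integral r ^ n * sin (real n * \<phi>)) {-pi..pi}"
    using has_integral_diff[OF has_integral_mult_right[OF M(1), of "sin (real n * \<phi>)"]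
        has_integral_mult_right[OF M(2), of "cos (real n * \<phi>)"]]
    unfolding sin_eq by (simp add: mult.commute)
  show C: "((\<lambda>\<theta>. poisson_kernel r (\<phi> - \<theta>) * cos (real n * \<theta>)) has_integral r ^ n * cos (real n * \<phi>)) {-pi..pi}"
    using has_integral_add[OF has_integral_mult_right[OF M(1), of "cos (real n * \<phi>)"]
        has_integral_mult_right[OF M(2), of "sin (real n * \<phi>)"]]
    unfolding cos_eq by (simp add: mult.commute)
  \<comment> \<open>This derivative combines the integrands of the third and the second claim, and
    the primitive vanishes at both ends because \<open>sin (real n * pi) = 0\<close>.\<close>
  have d: "((\<lambda>\<theta>. - (poisson_kernel r (\<phi> - \<theta>) * sin (real n * \<theta>))) has_real_derivative
      poisson_deriv r (\<phi> - \<theta>) * sin (real n * \<theta>) - real n * (poisson_kernel r (\<phi> - \<theta>) * cos (real n * \<theta>)))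
      (at \<theta> within {-pi..pi})" for \<theta>
  proof (rule has_field_derivative_at_within)
    have 1: "((\<lambda>\<theta>. \<phi> - \<theta>) has_real_derivative - 1) (at \<theta>)"
      by (auto intro!: derivative_eq_intros)
    have 2: "((\<lambda>\<theta>. sin (real n * \<theta>)) has_real_derivative real n * cos (real n * \<theta>)) (at \<theta>)"
      by (auto intro!: derivative_eq_intros)
    show "((\<lambda>\<theta>. - (poisson_kernel r (\<phi> - \<theta>) * sin (real n * \<theta>))) has_real_derivative
      poisson_deriv r (\<phi> - \<theta>) * sin (real n * \<theta>) - real n * (poisson_kernel r (\<phi> - \<theta>) * cos (real n * \<theta>))) (at \<theta>)"
      using DERIV_minus[OF DERIV_mult[OF DERIV_chain2[OF DERIV_poisson_kernel[OF less_imp_le[OF r(1)] r(2)] 1] 2]]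
      by (simp add: algebra_simps)
  qed
  have "((\<lambda>\<theta>. poisson_deriv r (\<phi> - \<theta>) * sin (real n * \<theta>) - real n * (poisson_kernel r (\<phi> - \<theta>) * cos (real n * \<theta>)))
      has_integral - (poisson_kernel r (\<phi> - pi) * sin (real n * pi))
        - - (poisson_kernel r (\<phi> - - pi) * sin (real n * - pi))) {-pi..pi}"
    by (rule fundamental_theorem_of_calculus)
      (use d in \<open>auto simp: has_real_derivative_iff_has_vector_derivative\<close>)
  from has_integral_add[OF this has_integral_mult_right[OF C, of "real n"]]
  show "((\<lambda>\<theta>. poisson_deriv r (\<phi> - \<theta>) * sin (real n * \<theta>)) has_integral real n * (r ^ n * cos (real n * \<phi>))) {-pi..pi}"
    by simp
qed

text \<open>Integration by parts produces a jointly continuous integrand, for which the integrals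
  may be exchanged; integration by parts against the sine then recovers the coefficient of
  \<open>f\<close>.\<close>

lemma sine_coefficient_poisson:
  fixes r :: real
  assumes f: "f integrable_on {-pi..pi}" and r: "0 < r" "r < 1"
  shows "integral {-pi..pi} (\<lambda>\<theta>. integral {-pi..pi} (\<lambda>\<phi>. f \<phi> * poisson_kernel r (\<phi> - \<theta>)) * sin (real n * \<theta>)) =
    r ^ n * integral {-pi..pi} (\<lambda>\<phi>. f \<phi> * sin (real n * \<phi>))"
proof -
  note r' = less_imp_le[OF r(1)] r(2)
  let ?c = "\<lambda>\<phi>. integral {-pi..\<phi>} f * (real n * cos (real n * \<phi>))"
  let ?k = "\<lambda>\<theta> \<phi>. integral {-pi..\<phi>} f * poisson_deriv r (\<phi> - \<theta>) * sin (real n * \<theta>)"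
  have cont: "continuous_on (UNIV \<times> {-pi..pi}) (\<lambda>(\<theta>, \<phi>). ?k \<theta> \<phi>)"
    using continuous_on_indefinite_poisson_deriv[OF f r'] unfolding split_beta
    by (rule continuous_on_mult) (intro continuous_intros)
  have split: "integral {-pi..pi} (\<lambda>\<phi>. f \<phi> * poisson_kernel r (\<phi> - \<theta>)) * sin (real n * \<theta>) =
      integral {-pi..pi} f * (poisson_kernel r (pi - \<theta>) * sin (real n * \<theta>)) - integral {-pi..pi} (?k \<theta>)" for \<theta>
    unfolding integral_unique[OF has_integral_poisson_by_parts[OF f r']]
    by (simp add: left_diff_distrib mult.assoc[of "integral {-pi..pi} f"])
  have k_int: "(\<lambda>\<theta>. integral {-pi..pi} (?k \<theta>)) integrable_on {-pi..pi}"
  proof -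
    have "continuous_on ({-pi..pi} \<times> cbox (-pi) pi) (\<lambda>(\<theta>, \<phi>). ?k \<theta> \<phi>)"
      by (rule continuous_on_subset[OF cont]) auto
    from integral_continuous_on_param[OF this] show ?thesis
      by (intro integrable_continuous_real) (simp only: cbox_interval)
  qed
  have "integral {-pi..pi} (\<lambda>\<theta>. integral {-pi..pi} (?k \<theta>)) =
      integral {-pi..pi} (\<lambda>\<phi>. integral {-pi..pi} (\<lambda>\<theta>. ?k \<theta> \<phi>))"
  proof -
    have "continuous_on (cbox (-pi, -pi) (pi, pi)) (\<lambda>(\<theta>, \<phi>). ?k \<theta> \<phi>)"
      by (rule continuous_on_subset[OF cont]) (auto simp: cbox_Pair_eq)
    from integral_swap_continuous[OF this] show ?thesis
      by (simp only: cbox_interval)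
  qed
  also have "\<dots> = integral {-pi..pi} (\<lambda>\<phi>. r ^ n * ?c \<phi>)"
  proof (rule integral_cong)
    fix \<phi>
    have "((\<lambda>\<theta>. ?k \<theta> \<phi>) has_integral integral {-pi..\<phi>} f * (real n * (r ^ n * cos (real n * \<phi>)))) {-pi..pi}"
      unfolding mult.assoc by (rule has_integral_mult_right[OF poisson_kernel_trig(3)[OF r, unfolded mult.assoc]])
    then show "integral {-pi..pi} (\<lambda>\<theta>. ?k \<theta> \<phi>) = r ^ n * ?c \<phi>"
      by (simp add: integral_unique)
  qed
  also have "\<dots> = r ^ n * integral {-pi..pi} ?c"
    by simp
  finally have swap: "integral {-pi..pi} (\<lambda>\<theta>. integral {-pi..pi} (?k \<theta>)) = r ^ n * integral {-pi..pi} ?c" .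
  have "((\<lambda>\<theta>. integral {-pi..pi} f * (poisson_kernel r (pi - \<theta>) * sin (real n * \<theta>)) - integral {-pi..pi} (?k \<theta>))
      has_integral integral {-pi..pi} f * (r ^ n * sin (real n * pi)) - r ^ n * integral {-pi..pi} ?c) {-pi..pi}"
    unfolding swap[symmetric]
    by (intro has_integral_diff has_integral_mult_right poisson_kernel_trig r integrable_integral k_int)
  moreover have "((\<lambda>\<phi>. f \<phi> * sin (real n * \<phi>)) has_integral
      integral {-pi..pi} f * sin (real n * pi) - integral {-pi..pi} ?c) {-pi..pi}"
    by (rule has_integral_by_parts_C1[OF _ f]) (auto intro!: derivative_eq_intros continuous_intros)
  ultimately show ?thesis
    unfolding split by (simp add: integral_unique)
qed

lemma sine_coefficient_le_L1_poisson:
  fixes r :: real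
  assumes f: "f integrable_on {-pi..pi}" and r: "0 < r" "r < 1"
  shows "r ^ n * \<bar>integral {-pi..pi} (\<lambda>\<phi>. f \<phi> * sin (real n * \<phi>))\<bar> \<le>
    integral {-pi..pi} (\<lambda>\<theta>. \<bar>integral {-pi..pi} (\<lambda>\<phi>. f \<phi> * poisson_kernel r (\<phi> - \<theta>))\<bar>)"
    (is "_ \<le> integral _ (\<lambda>\<theta>. \<bar>?u \<theta>\<bar>)")
proof -
  have u: "continuous_on {-pi..pi} ?u"
    using continuous_on_poisson[OF f less_imp_le[OF r(1)] r(2)] continuous_on_subset by blast
  have "r ^ n * \<bar>integral {-pi..pi} (\<lambda>\<phi>. f \<phi> * sin (real n * \<phi>))\<bar> = norm (integral {-pi..pi} (\<lambda>\<theta>. ?u \<theta> * sin (real n * \<theta>)))"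
    unfolding sine_coefficient_poisson[OF assms] using r by (simp add: abs_mult)
  also have "\<dots> \<le> integral {-pi..pi} (\<lambda>\<theta>. \<bar>?u \<theta>\<bar>)"
    by (intro Henstock_Kurzweil_Integration.integral_norm_bound_integral integrable_continuous_real continuous_intros u)
      (auto simp: abs_mult intro: mult_left_le)
  finally show ?thesis .
qed

section \<open>Upper estimates\<close>

lemma enn_smallo_1I:
  assumes "\<And>e. 0 < e \<Longrightarrow> \<forall>\<^sub>F r in at_left 1. g r \<le> ennreal (e / (1 - r))"
  shows "enn_smallo_1 g (\<lambda>r. 1 / (1 - r))"
  unfolding enn_smallo_1_def
proof (rule order_tendstoI)
  fix a :: ennreal assume "0 < a"
  \<comment> \<open>A real number strictly below \<open>a\<close>: half of a finite
    \<open>a\<close>, or 1 if \<open>a\<close> is infinite.\<close>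
  then obtain e where e: "0 < e" "ennreal e < a"
  proof (cases a)
    case (real x)
    with \<open>0 < a\<close> that[of "x / 2"] show thesis
      by (auto simp: ennreal_less_iff)
  next
    case top
    with that[of 1] show thesis by simp
  qed
  have "\<forall>\<^sub>F r in at_left 1. r < (1::real)"
    by (simp add: eventually_at_filter)
  with assms[OF e(1)] show "\<forall>\<^sub>F r in at_left 1. g r / ennreal (1 / (1 - r)) < a"
  proof eventually_elim
    case (elim r)
    then have "g r / ennreal (1 / (1 - r)) \<le> ennreal (e / (1 - r)) / ennreal (1 / (1 - r))"
      by (intro divide_right_mono_ennreal)
    also have "\<dots> = ennreal e"
      using elim e by (simp add: divide_ennreal)
    finally show ?case
      using e by simp
  qed
qed simp

text \<open>In the splitting \<open>(f - s) + s\<close> the first part has a small primitive, while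
  the continuous part has a Poisson integral bounded by \<open>M\<close>, eventually below
  \<open>e / 2 / (1 - r)\<close>.\<close>

lemma poisson_integral_uniform_smallo:
  assumes "f \<in> HK" and e: "0 < e"
  shows "\<forall>\<^sub>F r in at_left 1. \<forall>\<theta>. \<bar>poisson_integral f (rcis r \<theta>)\<bar> \<le> e / (1 - r)"
proof -
  have f: "f integrable_on {-pi..pi}"
    by (rule HK_integrable[OF assms(1)])
  \<comment> \<open>The tolerance \<open>e / 6\<close> becomes \<open>e / 2\<close> after the factor
    3 of \<open>abs_poisson_le\<close>.\<close>
  obtain s where s: "continuous_on UNIV s"
    and fs: "\<And>x. x \<in> {-pi..pi} \<Longrightarrow> \<bar>integral {-pi..x} (\<lambda>t. f t - s t)\<bar> \<le> e / 6"
    using continuous_approx_primitive[OF f, of "e / 6"] e by auto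
  have s': "continuous_on {-pi..pi} s"
    using s continuous_on_subset by blast
  then have "bounded (s ` {-pi..pi})"
    by (intro compact_imp_bounded compact_continuous_image) auto
  then obtain M where "M > 0" and M: "\<And>x. x \<in> {-pi..pi} \<Longrightarrow> \<bar>s x\<bar> \<le> M"
    unfolding bounded_pos by auto
  have fs_int: "(\<lambda>t. f t - s t) integrable_on {-pi..pi}"
    by (intro integrable_diff f integrable_continuous_real s')
  have bound: "\<bar>poisson_integral f (rcis r \<theta>)\<bar> \<le> e / 2 / (1 - r) + M" if r: "0 \<le> r" "r < 1" for r \<theta>
  proof -
    let ?K = "\<lambda>\<phi>. poisson_kernel r (\<phi> - \<theta>)"
    have K: "(?K has_integral 1) {-pi..pi}"
      using has_integral_poisson_kernel[OF r, of \<theta>] by (simp add: poisson_kernel_minus_commute)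
    have sK: "(\<lambda>\<phi>. s \<phi> * ?K \<phi>) integrable_on {-pi..pi}"
      by (intro integrable_continuous_real continuous_intros continuous_on_poisson_kernel s' r)
    have "norm (integral {-pi..pi} (\<lambda>\<phi>. s \<phi> * ?K \<phi>)) \<le> integral {-pi..pi} (\<lambda>\<phi>. M * ?K \<phi>)"
      using M K poisson_kernel_pos[OF r]
      by (intro Henstock_Kurzweil_Integration.integral_norm_bound_integral sK)
        (auto simp: abs_mult integrable_on_def less_imp_le intro!: mult_right_mono has_integral_mult_right)
    also have "\<dots> = M"
      unfolding integral_unique[OF has_integral_mult_right[OF K, of M]] by simp
    finally have 1: "\<bar>integral {-pi..pi} (\<lambda>\<phi>. s \<phi> * ?K \<phi>)\<bar> \<le> M"
      by simp
    have 2: "\<bar>integral {-pi..pi} (\<lambda>\<phi>. (f \<phi> - s \<phi>) * ?K \<phi>)\<bar> \<le> e / 2 / (1 - r)"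
      using abs_poisson_le[OF fs_int r fs, of \<theta>] by simp
    have "integral {-pi..pi} (\<lambda>\<phi>. f \<phi> * ?K \<phi>) =
        integral {-pi..pi} (\<lambda>\<phi>. (f \<phi> - s \<phi>) * ?K \<phi>) + integral {-pi..pi} (\<lambda>\<phi>. s \<phi> * ?K \<phi>)"
      using integral_add[OF has_integral_integrable[OF has_integral_poisson_by_parts[OF fs_int r, of \<theta>]] sK]
      by (simp add: left_diff_distrib)
    then show ?thesis
      unfolding poisson_integral_rcis[OF r(1)] using 1 2 by linarith
  qed
  \<comment> \<open>The threshold solves \<open>M * (1 - r) \<le> e / 2\<close>; the maximum with 0
    ensures \<open>0 \<le> r\<close>.\<close>
  have "\<forall>\<^sub>F r in at_left 1. max 0 (1 - e / (2 * M)) < r \<and> r < 1"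
    using eventually_at_left_real[of "max 0 (1 - e / (2 * M))" 1] e \<open>M > 0\<close> by simp
  then show ?thesis
  proof eventually_elim
    case (elim r)
    then have r: "0 \<le> r" "r < 1" "1 - e / (2 * M) < r"
      by auto
    have "M * (1 - r) \<le> M * (e / (2 * M))"
      using r(3) \<open>M > 0\<close> by (intro mult_left_mono) auto
    also have "\<dots> = e / 2"
      using \<open>M > 0\<close> by simp
    finally have "M * (1 - r) \<le> e / 2" .
    then have "M \<le> e / 2 / (1 - r)"
      by (subst pos_le_divide_eq) (use r in auto)
    moreover have "e / 2 / (1 - r) + e / 2 / (1 - r) = e / (1 - r)"
      unfolding add_divide_distrib[symmetric] by simp
    ultimately have "e / 2 / (1 - r) + M \<le> e / (1 - r)"
      by linarith
    then show ?case
      using order_trans[OF bound[OF r(1,2)]] by blast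
  qed
qed

section \<open>Comparison of the L^p norm with the supremum and the L^1 norm\<close>

lemma Lp_norm_le:
  assumes p: "1 \<le> p" and B: "\<And>\<theta>. \<bar>u \<theta>\<bar> \<le> B"
  shows "Lp_norm p u \<le> ennreal (2 * pi * B)"
proof -
  have "0 \<le> B"
    using B[of 0] by linarith
  define J where "J = (\<integral>\<^sup>+\<theta>\<in>{-pi..pi}. ennreal (\<bar>u \<theta>\<bar> powr p) \<partial>lebesgue)"
  have "J \<le> (\<integral>\<^sup>+\<theta>\<in>{-pi..pi}. ennreal (B powr p) \<partial>lebesgue)"
    unfolding J_def using p B
    by (intro nn_integral_mono mult_right_mono ennreal_leI powr_mono2) auto
  also have "\<dots> = ennreal (B powr p * (2 * pi))"
    by (simp add: nn_integral_cmult_indicator ennreal_mult)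
  finally have J: "J \<le> ennreal (B powr p * (2 * pi))" .
  then have "J \<noteq> \<infinity>"
    by (auto simp: top_unique)
  have "enn2real J powr (1 / p) \<le> (B powr p * (2 * pi)) powr (1 / p)"
    using J p by (intro powr_mono2 enn2real_leI) auto
  also have "\<dots> = B * (2 * pi) powr (1 / p)"
    using \<open>0 \<le> B\<close> p by (simp add: powr_mult powr_powr)
  \<comment> \<open>As \<open>1 / p \<le> 1\<close> and \<open>2 * pi \<ge> 1\<close>, the constant
    can be made independent of \<open>p\<close>.\<close>
  also have "\<dots> \<le> B * (2 * pi) powr 1"
    using \<open>0 \<le> B\<close> p pi_ge_two by (intro mult_left_mono powr_mono) auto
  finally show ?thesis
    using \<open>J \<noteq> \<infinity>\<close> unfolding Lp_norm_def Let_def J_def[symmetric] by (auto intro!: ennreal_leI simp: mult_ac)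
qed

text \<open>Integrating \<open>t \<le> \<lambda> + t\<^sup>p \<lambda>\<^sup>1\<^sup>-\<^sup>p\<close>, with \<open>\<lambda>\<close> slightly above the \<open>L\<^sup>p\<close> norm, replaces Hoelder's
  inequality here.\<close>

lemma L1_le_Lp_norm:
  assumes p: "1 \<le> p" and u: "continuous_on {-pi..pi} u"
  shows "ennreal (integral {-pi..pi} (\<lambda>\<theta>. \<bar>u \<theta>\<bar>) / (2 * pi + 1)) \<le> Lp_norm p u"
proof -
  let ?I = "integral {-pi..pi} (\<lambda>\<theta>. \<bar>u \<theta>\<bar>)"
  define j where "j = integral {-pi..pi} (\<lambda>\<theta>. \<bar>u \<theta>\<bar> powr p)"
  have cont: "continuous_on {-pi..pi} (\<lambda>\<theta>. \<bar>u \<theta>\<bar> powr p)"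
    using p by (intro continuous_on_powr' continuous_intros u) auto
  then have j: "((\<lambda>\<theta>. \<bar>u \<theta>\<bar> powr p) has_integral j) {-pi..pi}"
    unfolding j_def by (intro integrable_integral integrable_continuous_real)
  then have "0 \<le> j"
    by (rule has_integral_nonneg) simp
  have Lp: "Lp_norm p u = ennreal (j powr (1 / p))"
    using nn_integral_has_integral_lebesgue'[OF _ j] \<open>0 \<le> j\<close>
    unfolding Lp_norm_def Let_def by (simp add: nn_integral_completion)
  have bound: "?I \<le> (2 * pi + 1) * t" if t: "0 < t" "j \<le> t powr p" for t
  proof -
    have pw: "\<bar>u \<theta>\<bar> \<le> t + \<bar>u \<theta>\<bar> powr p * t powr (1 - p)" for \<theta>
    proof (cases "\<bar>u \<theta>\<bar> \<le> t")
      case True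
      then show ?thesis by (simp add: add_increasing2)
    next
      case False
      \<comment> \<open>Above \<open>t\<close> the factor
        \<open>(\<bar>u \<theta>\<bar> / t) powr (p - 1)\<close> is at least 1, so the second
        summand alone dominates.\<close>
      then have "t powr (p - 1) \<le> \<bar>u \<theta>\<bar> powr (p - 1)"
        using p t by (intro powr_mono2) auto
      then have "\<bar>u \<theta>\<bar> * (t powr (p - 1) * t powr (1 - p)) \<le> \<bar>u \<theta>\<bar> * (\<bar>u \<theta>\<bar> powr (p - 1) * t powr (1 - p))"
        by (intro mult_left_mono mult_right_mono) auto
      moreover have "t powr (p - 1) * t powr (1 - p) = 1"
        using t by (simp flip: powr_add)
      moreover have "\<bar>u \<theta>\<bar> * \<bar>u \<theta>\<bar> powr (p - 1) = \<bar>u \<theta>\<bar> powr p"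
        using False t powr_mult_base[of "\<bar>u \<theta>\<bar>" "p - 1"] by simp
      ultimately show ?thesis
        using t by (simp flip: mult.assoc)
    qed
    have "((\<lambda>\<theta>. t + \<bar>u \<theta>\<bar> powr p * t powr (1 - p)) has_integral (2 * pi * t + j * t powr (1 - p))) {-pi..pi}"
      using has_integral_const_real[of t "-pi" pi]
      by (intro has_integral_add has_integral_mult_left j) simp
    then have "?I \<le> 2 * pi * t + j * t powr (1 - p)"
      by (intro has_integral_le[OF integrable_integral _ pw] integrable_continuous_real continuous_intros u)
    also have "j * t powr (1 - p) \<le> t powr p * t powr (1 - p)"
      using t by (intro mult_right_mono) auto
    also have "\<dots> = t"
      using t by (simp flip: powr_add)
    finally show ?thesis
      by (simp add: algebra_simps)
  qed
  have "?I / (2 * pi + 1) \<le> j powr (1 / p)"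
  \<comment> \<open>\<open>bound\<close> asks for a positive \<open>t\<close>, while
    \<open>j\<close> may be 0; adding \<open>e\<close> covers that case.\<close>
  proof (rule field_le_epsilon)
    fix e :: real assume e: "0 < e"
    have "j = (j powr (1 / p)) powr p"
      using \<open>0 \<le> j\<close> p by (simp add: powr_powr)
    also have "\<dots> \<le> (j powr (1 / p) + e) powr p"
      using p e by (intro powr_mono2) auto
    finally have "?I \<le> (2 * pi + 1) * (j powr (1 / p) + e)"
      using e by (intro bound) (auto intro: add_nonneg_pos)
    then show "?I / (2 * pi + 1) \<le> j powr (1 / p) + e"
      by (simp add: pos_divide_le_eq add_pos_pos mult.commute)
  qed
  then show ?thesis
    unfolding Lp by (rule ennreal_leI)
qed

section \<open>Sharpness\<close>

text \<open>Sharpness asks only for failure along a sequence of radii, and up to constants the L^1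
  norm is the smallest norm involved, so this radial statement serves both the supremum and every
  L^p norm.\<close>

lemma HK_L1_poisson_sharp:
  fixes \<psi> :: "real \<Rightarrow> real"
  assumes \<psi>: "((\<lambda>r. (1 - r) * \<psi> r) \<longlongrightarrow> 0) (at_left 1)"
  obtains f R where "f \<in> HK" and "\<And>k::nat. 0 < R k" and "\<And>k. R k < 1" and "filterlim R (at_left 1) sequentially"
    and "\<And>k. \<psi> (R k) \<le> 24 * integral {-pi..pi} (\<lambda>\<theta>. \<bar>poisson_integral f (rcis (R k) \<theta>)\<bar>)"
proof -
  \<comment> \<open>With \<open>n = Suc m\<close> this is the radius \<open>1 - 1 / (2 * n)\<close>,
    at which Bernoulli's inequality keeps \<open>r ^ n\<close> at least 1/2.\<close>
  define \<rho> where "\<rho> m = 1 - 1/2 * inverse (real (Suc m))" for m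
  have \<rho>: "0 < \<rho> m" "\<rho> m < 1" for m
  proof -
    have "inverse (real (Suc m)) \<le> 1"
      by (rule inverse_le_1_iff[THEN iffD2]) simp
    moreover have "0 < inverse (real (Suc m))"
      by simp
    ultimately show "0 < \<rho> m" "\<rho> m < 1"
      unfolding \<rho>_def by linarith+
  qed
  have "\<rho> \<longlonglongrightarrow> 1 - 1/2 * 0"
    unfolding \<rho>_def by (intro tendsto_diff tendsto_const tendsto_mult_left LIMSEQ_inverse_real_of_nat)
  then have \<rho>_lim: "filterlim \<rho> (at_left 1) sequentially"
    using \<rho> by (auto simp: filterlim_at less_imp_neq intro!: always_eventually)
  have "(\<lambda>m. (1 - \<rho> m) * \<psi> (\<rho> m)) \<longlonglongrightarrow> 0"
    by (rule filterlim_compose[OF \<psi> \<rho>_lim])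
  then have "\<forall>\<^sub>F m in sequentially. (1 - \<rho> m) * \<psi> (\<rho> m) < (1/4) ^ k" for k
    by (rule order_tendstoD) simp
  \<comment> \<open>The condition \<open>m \<ge> k\<close> drives the radii to 1; the other one
    offsets the factor \<open>(1/4) ^ k\<close> in the coefficient bound.\<close>
  then have "\<exists>m\<ge>k. (1 - \<rho> m) * \<psi> (\<rho> m) < (1/4) ^ k" for k :: nat
    unfolding eventually_sequentially by (metis linorder_linear order_refl)
  then obtain m where m: "\<And>k. k \<le> m k" "\<And>k. (1 - \<rho> (m k)) * \<psi> (\<rho> (m k)) < (1/4) ^ k"
    by metis
  obtain f where f: "f \<in> HK" and coeff:
    "\<And>k. real (Suc (m k)) * (1/4) ^ k / 6 \<le> \<bar>integral {-pi..pi} (\<lambda>x. f x * sin (real (Suc (m k)) * x))\<bar>"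
    using HK_large_sine_coefficients[of "\<lambda>k. Suc (m k)"] by blast
  show thesis
  proof
    show "f \<in> HK" by fact
    show "0 < (\<rho> \<circ> m) k" "(\<rho> \<circ> m) k < 1" for k
      by (simp_all add: \<rho>)
    have "filterlim m at_top sequentially"
      using m(1) by (intro filterlim_at_top_mono[OF filterlim_ident]) auto
    then show "filterlim (\<rho> \<circ> m) (at_left 1) sequentially"
      unfolding comp_def by (rule filterlim_compose[OF \<rho>_lim])
    fix k
    let ?N = "Suc (m k)" and ?r = "\<rho> (m k)"
    let ?a = "\<bar>integral {-pi..pi} (\<lambda>x. f x * sin (real ?N * x))\<bar>"
    have "1 + real ?N * (- (1/2 * inverse (real ?N))) \<le> (1 + - (1/2 * inverse (real ?N))) ^ ?N"
      using \<rho>[of "m k"] unfolding \<rho>_def by (intro Bernoulli_inequality) linarith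
    then have half: "1 / 2 \<le> ?r ^ ?N"
      by (simp add: \<rho>_def del: power_Suc of_nat_Suc)
    \<comment> \<open>Here \<open>1 - ?r = 1 / (2 * ?N)\<close>. The constant 24 is the product of
      this 2, the 6 of the coefficient bound and the 2 of \<open>half\<close>.\<close>
    have "\<psi> ?r = 2 * real ?N * ((1 - ?r) * \<psi> ?r)"
      by (simp add: \<rho>_def del: of_nat_Suc)
    also have "\<dots> \<le> 2 * real ?N * (1/4) ^ k"
      using less_imp_le[OF m(2)[of k]] by (intro mult_left_mono) auto
    also have "\<dots> \<le> 24 * (1 / 2 * ?a)"
      using coeff[of k] by (simp add: mult.assoc del: of_nat_Suc)
    also have "\<dots> \<le> 24 * (?r ^ ?N * ?a)"
      using half by (intro mult_left_mono mult_right_mono) auto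
    also have "\<dots> \<le> 24 * integral {-pi..pi} (\<lambda>\<theta>. \<bar>poisson_integral f (rcis ?r \<theta>)\<bar>)"
      unfolding poisson_integral_rcis[OF less_imp_le[OF \<rho>(1)]]
      by (intro mult_left_mono sine_coefficient_le_L1_poisson HK_integrable f \<rho>) simp
    finally show "\<psi> ((\<rho> \<circ> m) k) \<le> 24 * integral {-pi..pi} (\<lambda>\<theta>. \<bar>poisson_integral f (rcis ((\<rho> \<circ> m) k) \<theta>)\<bar>)"
      by simp
  qed
qed

lemma continuous_on_poisson_integral_rcis:
  assumes "f \<in> HK" "0 \<le> r" "r < 1"
  shows "continuous_on {-pi..pi} (\<lambda>\<theta>. poisson_integral f (rcis r \<theta>))"
  unfolding poisson_integral_rcis[OF assms(2)]
  by (rule continuous_on_subset[OF continuous_on_poisson[OF HK_integrable]]) (use assms in auto)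

theorem theorem1:
  shows
    "(\<forall>f\<in>HK.
        enn_smallo_1 (\<lambda>r. SUP \<theta>\<in>{-pi..pi}. ennreal \<bar>poisson_integral f (rcis r \<theta>)\<bar>)
                     (\<lambda>r. 1 / (1 - r)))
   \<and> (\<forall>\<psi> :: complex \<Rightarrow> real.
        (\<forall>z\<in>ball 0 1. 0 < \<psi> z) \<longrightarrow>
        ((\<lambda>r. SUP \<theta>\<in>{-pi..pi}. ennreal ((1 - r) * \<psi> (rcis r \<theta>))) \<longlongrightarrow> 0) (at_left 1) \<longrightarrow>
        (\<exists>f\<in>HK.
           \<not> ((\<lambda>r. SUP \<theta>\<in>{-pi..pi}. ennreal (\<bar>poisson_integral f (rcis r \<theta>)\<bar> / \<psi> (rcis r \<theta>)))
                 \<longlongrightarrow> 0) (at_left 1)))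
   \<and> (\<forall>p::real. 1 \<le> p \<longrightarrow>
       (\<forall>f\<in>HK.
          enn_smallo_1 (\<lambda>r. Lp_norm p (\<lambda>\<theta>. poisson_integral f (rcis r \<theta>))) (\<lambda>r. 1 / (1 - r)))
     \<and> (\<forall>\<psi> :: real \<Rightarrow> real.
          (\<forall>r\<in>{0..<1}. 0 < \<psi> r) \<longrightarrow>
          \<psi> \<in> o[at_left 1](\<lambda>r. 1 / (1 - r)) \<longrightarrow>
          (\<exists>f\<in>HK.
             \<not> enn_smallo_1 (\<lambda>r. Lp_norm p (\<lambda>\<theta>. poisson_integral f (rcis r \<theta>))) \<psi>)))"
proof (intro conjI ballI allI impI)
  fix f :: "real \<Rightarrow> real" assume f: "f \<in> HK"
  show "enn_smallo_1 (\<lambda>r. SUP \<theta>\<in>{-pi..pi}. ennreal \<bar>poisson_integral f (rcis r \<theta>)\<bar>) (\<lambda>r. 1 / (1 - r))"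
  proof (rule enn_smallo_1I)
    fix e :: real assume "0 < e"
    from poisson_integral_uniform_smallo[OF f this]
    show "\<forall>\<^sub>F r in at_left 1. (SUP \<theta>\<in>{-pi..pi}. ennreal \<bar>poisson_integral f (rcis r \<theta>)\<bar>) \<le> ennreal (e / (1 - r))"
      by eventually_elim (auto intro!: SUP_least ennreal_leI)
  qed
next
  fix p :: real and f :: "real \<Rightarrow> real" assume p: "1 \<le> p" and f: "f \<in> HK"
  show "enn_smallo_1 (\<lambda>r. Lp_norm p (\<lambda>\<theta>. poisson_integral f (rcis r \<theta>))) (\<lambda>r. 1 / (1 - r))"
  proof (rule enn_smallo_1I)
    fix e :: real assume "0 < e"
    \<comment> \<open>Compensates for the factor \<open>2 * pi\<close> of
      \<open>Lp_norm_le\<close>.\<close>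
    then have "0 < e / (2 * pi)"
      by simp
    from poisson_integral_uniform_smallo[OF f this]
    show "\<forall>\<^sub>F r in at_left 1. Lp_norm p (\<lambda>\<theta>. poisson_integral f (rcis r \<theta>)) \<le> ennreal (e / (1 - r))"
    proof eventually_elim
      case (elim r)
      from Lp_norm_le[OF p elim[rule_format]] show ?case
        by simp
    qed
  qed
next
  fix \<psi> :: "complex \<Rightarrow> real"
  assume pos: "\<forall>z\<in>ball 0 1. 0 < \<psi> z"
    and lim: "((\<lambda>r. SUP \<theta>\<in>{-pi..pi}. ennreal ((1 - r) * \<psi> (rcis r \<theta>))) \<longlongrightarrow> 0) (at_left 1)"
  \<comment> \<open>Where \<open>S r\<close> is finite, \<open>enn2real (S r) / (1 - r)\<close> is a
    radial majorant of \<open>\<psi>\<close>, to which the radial sharpness result applies.\<close>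
  define S where "S r = (SUP \<theta>\<in>{-pi..pi}. ennreal ((1 - r) * \<psi> (rcis r \<theta>)))" for r
  have "((\<lambda>r. enn2real (S r)) \<longlongrightarrow> 0) (at_left 1)"
    using lim by (intro tendsto_enn2real) (simp_all add: S_def)
  moreover have "\<forall>\<^sub>F r in at_left 1. enn2real (S r) = (1 - r) * (enn2real (S r) / (1 - r))"
    by (auto simp: eventually_at_filter)
  ultimately have "((\<lambda>r. (1 - r) * (enn2real (S r) / (1 - r))) \<longlongrightarrow> 0) (at_left 1)"
    by (rule Lim_transform_eventually)
  from HK_L1_poisson_sharp[OF this] obtain f R where f: "f \<in> HK" and R: "\<And>k::nat. 0 < R k" "\<And>k. R k < 1"
    and R_lim: "filterlim R (at_left 1) sequentially"
    and large: "\<And>k. enn2real (S (R k)) / (1 - R k) \<le> 24 * integral {-pi..pi} (\<lambda>\<theta>. \<bar>poisson_integral f (rcis (R k) \<theta>)\<bar>)"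
    by blast
  have "\<not> ((\<lambda>r. SUP \<theta>\<in>{-pi..pi}. ennreal (\<bar>poisson_integral f (rcis r \<theta>)\<bar> / \<psi> (rcis r \<theta>))) \<longlongrightarrow> 0) (at_left 1)"
  proof
    assume small: "((\<lambda>r. SUP \<theta>\<in>{-pi..pi}. ennreal (\<bar>poisson_integral f (rcis r \<theta>)\<bar> / \<psi> (rcis r \<theta>))) \<longlongrightarrow> 0) (at_left 1)"
    \<comment> \<open>Over the length \<open>2 * pi\<close> this integrates to 1/48, so with the
      factor 24 the assumption would give \<open>\<sigma> \<le> \<sigma> / 2\<close>.\<close>
    define c where "c = 1 / (96 * pi)"
    have "c > 0"
      by (simp add: c_def)
    have "\<forall>\<^sub>F k in sequentially. (SUP \<theta>\<in>{-pi..pi}. ennreal (\<bar>poisson_integral f (rcis (R k) \<theta>)\<bar> / \<psi> (rcis (R k) \<theta>))) < ennreal c"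
      by (rule order_tendstoD(2)[OF filterlim_compose[OF small R_lim]]) (simp add: \<open>c > 0\<close>)
    \<comment> \<open>Excludes radii with infinite \<open>S\<close>, where \<open>enn2real\<close>
      returns 0 and the majorant fails.\<close>
    moreover have "\<forall>\<^sub>F k in sequentially. S (R k) < 1"
      by (rule order_tendstoD(2)[OF filterlim_compose[OF lim[folded S_def] R_lim]]) simp
    ultimately have "\<forall>\<^sub>F k in sequentially. False"
    proof eventually_elim
      case (elim k)
      define r and \<sigma> where "r = R k" and "\<sigma> = enn2real (S r) / (1 - r)"
      let ?u = "\<lambda>\<theta>. poisson_integral f (rcis r \<theta>)"
      have r: "0 < r" "r < 1"
        using R by (simp_all add: r_def)
      have \<psi>_pos: "0 < \<psi> (rcis r \<theta>)" for \<theta>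
        using pos r by (simp add: dist_norm)
      have "S r \<noteq> top"
        using elim by (auto simp: r_def)
      have \<psi>_le: "\<psi> (rcis r \<theta>) \<le> \<sigma>" if "\<theta> \<in> {-pi..pi}" for \<theta>
      proof -
        have "ennreal ((1 - r) * \<psi> (rcis r \<theta>)) \<le> S r"
          unfolding S_def using that by (rule SUP_upper)
        then have "(1 - r) * \<psi> (rcis r \<theta>) \<le> enn2real (S r)"
          using \<open>S r \<noteq> top\<close> r \<psi>_pos[of \<theta>] enn2real_mono[of "ennreal ((1 - r) * \<psi> (rcis r \<theta>))" "S r"]
          by (simp add: top.not_eq_extremum)
        then show ?thesis
          using r by (simp add: \<sigma>_def pos_le_divide_eq mult.commute)
      qed
      from \<psi>_le[of 0] have "0 < \<sigma>"
        using \<psi>_pos[of 0] by simp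
      have u_le: "\<bar>?u \<theta>\<bar> \<le> c * \<sigma>" if "\<theta> \<in> {-pi..pi}" for \<theta>
      proof -
        have "ennreal (\<bar>?u \<theta>\<bar> / \<psi> (rcis r \<theta>)) \<le> ennreal c"
          using elim(1) SUP_upper[OF that, of "\<lambda>\<theta>. ennreal (\<bar>?u \<theta>\<bar> / \<psi> (rcis r \<theta>))"]
          unfolding r_def by (meson less_imp_le order_trans)
        then have "\<bar>?u \<theta>\<bar> \<le> c * \<psi> (rcis r \<theta>)"
          using \<open>c > 0\<close> \<psi>_pos[of \<theta>] by (simp add: divide_le_eq)
        also have "\<dots> \<le> c * \<sigma>"
          using \<psi>_le[OF that] \<open>c > 0\<close> by simp
        finally show ?thesis .
      qed
      have "integral {-pi..pi} (\<lambda>\<theta>. \<bar>?u \<theta>\<bar>) \<le> integral {-pi..pi} (\<lambda>\<theta>. c * \<sigma>)"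
        using u_le r f by (intro integral_le integrable_continuous_real continuous_intros
            continuous_on_poisson_integral_rcis) auto
      also have "\<dots> = \<sigma> / 48"
        by (simp add: c_def)
      finally show False
        using large[of k, folded r_def, folded \<sigma>_def] \<open>0 < \<sigma>\<close> by linarith
    qed
    then show False
      by simp
  qed
  with f show "\<exists>f\<in>HK. \<not> ((\<lambda>r. SUP \<theta>\<in>{-pi..pi}. ennreal (\<bar>poisson_integral f (rcis r \<theta>)\<bar> / \<psi> (rcis r \<theta>))) \<longlongrightarrow> 0) (at_left 1)"
    by blast
next
  fix p :: real and \<psi> :: "real \<Rightarrow> real"
  assume p: "1 \<le> p" and pos: "\<forall>r\<in>{0..<1}. 0 < \<psi> r" and "\<psi> \<in> o[at_left 1](\<lambda>r. 1 / (1 - r))"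
  then have "((\<lambda>r. (1 - r) * \<psi> r) \<longlongrightarrow> 0) (at_left 1)"
    using smalloD_tendsto[of \<psi> "at_left 1" "\<lambda>r. 1 / (1 - r)"] by (simp add: mult.commute)
  from HK_L1_poisson_sharp[OF this] obtain f R where f: "f \<in> HK" and R: "\<And>k::nat. 0 < R k" "\<And>k. R k < 1"
    and R_lim: "filterlim R (at_left 1) sequentially"
    and large: "\<And>k. \<psi> (R k) \<le> 24 * integral {-pi..pi} (\<lambda>\<theta>. \<bar>poisson_integral f (rcis (R k) \<theta>)\<bar>)"
    by blast
  \<comment> \<open>The factor 24 comes from \<open>large\<close> and \<open>2 * pi + 1\<close> from
    \<open>L1_le_Lp_norm\<close>; together they bound the L^p norm below by
    \<open>c * \<psi> (R k)\<close>.\<close>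
  define c where "c = 1 / (24 * (2 * pi + 1))"
  have "c > 0"
    by (simp add: c_def add_pos_pos)
  have "\<not> enn_smallo_1 (\<lambda>r. Lp_norm p (\<lambda>\<theta>. poisson_integral f (rcis r \<theta>))) \<psi>"
  proof
    assume "enn_smallo_1 (\<lambda>r. Lp_norm p (\<lambda>\<theta>. poisson_integral f (rcis r \<theta>))) \<psi>"
    then have "\<forall>\<^sub>F k in sequentially. Lp_norm p (\<lambda>\<theta>. poisson_integral f (rcis (R k) \<theta>)) / ennreal (\<psi> (R k)) < ennreal c"
      unfolding enn_smallo_1_def
      by (rule order_tendstoD(2)[OF filterlim_compose[OF _ R_lim]]) (simp add: \<open>c > 0\<close>)
    then have "\<forall>\<^sub>F k in sequentially. False"
    proof eventually_elim
      case (elim k)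
      let ?u = "\<lambda>\<theta>. poisson_integral f (rcis (R k) \<theta>)"
      have "0 < \<psi> (R k)"
        using pos R[of k] by (simp add: less_imp_le)
      have "c * \<psi> (R k) = \<psi> (R k) / 24 / (2 * pi + 1)"
        by (simp add: c_def)
      also have "\<dots> \<le> integral {-pi..pi} (\<lambda>\<theta>. \<bar>?u \<theta>\<bar>) / (2 * pi + 1)"
        using large[of k] pi_gt_zero by (intro divide_right_mono) auto
      also have "ennreal \<dots> \<le> Lp_norm p ?u"
        using R[of k] by (intro L1_le_Lp_norm[OF p] continuous_on_poisson_integral_rcis f) auto
      finally have "ennreal (c * \<psi> (R k)) / ennreal (\<psi> (R k)) \<le> Lp_norm p ?u / ennreal (\<psi> (R k))"
        by (intro divide_right_mono_ennreal) (simp add: ennreal_leI)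
      moreover have "ennreal (c * \<psi> (R k)) / ennreal (\<psi> (R k)) = ennreal c"
        using \<open>0 < \<psi> (R k)\<close> \<open>c > 0\<close> by (simp add: divide_ennreal)
      ultimately show False
        using elim by simp
    qed
    then show False
      by simp
  qed
  with f show "\<exists>f\<in>HK. \<not> enn_smallo_1 (\<lambda>r. Lp_norm p (\<lambda>\<theta>. poisson_integral f (rcis r \<theta>))) \<psi>"
    by blast
qed

end
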